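(* Let $G\in\mathcal G^3_2$ and suppose that no connected component of $G$ has exactly $5$ vertices. Then $\lambda(G)\ge v(G)/4$.
   Context: All graphs are finite and simple. For integers $1\le r\le s$, $\mathcal G^s_r$ denotes the set of graphs in which every vertex has degree at least $r$ and at most $s$. $v(G)$ is the number of vertices of $G$. $\lambda(G)$ denotes the maximum number of pairwise vertex-disjoint subgraphs of $G$ each of which is a path with exactly two edges. *)

theory Defs
  imports Complex_Main
begin

definition simple_graph :: "'a set \<Rightarrow> 'a set set \<Rightarrow> bool" where
  "simple_graph V E \<longleftrightarrow> finite V \<and> (\<forall>e\<in>E. e \<subseteq> V \<and> card e = 2)"

definition degree :: "'a set set \<Rightarrow> 'a \<Rightarrow> nat" where
  "degree E v = card {e\<in>E. v \<in> e}"

definition in_G :: "nat \<Rightarrow> nat \<Rightarrow> 'a set \<Rightarrow> 'a set set \<Rightarrow> bool" where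
  "in_G r s V E \<longleftrightarrow> simple_graph V E \<and> (\<forall>v\<in>V. r \<le> degree E v \<and> degree E v \<le> s)"

definition reachable :: "'a set \<Rightarrow> 'a set set \<Rightarrow> 'a \<Rightarrow> 'a \<Rightarrow> bool" where
  "reachable V E u w \<longleftrightarrow> u \<in> V \<and> w \<in> V \<and>
     (u, w) \<in> {(x, y). {x, y} \<in> E}\<^sup>*"

definition components :: "'a set \<Rightarrow> 'a set set \<Rightarrow> 'a set set" where
  "components V E = (\<lambda>v. {w. reachable V E v w}) ` V"

definition is_P3 :: "'a set set \<Rightarrow> 'a \<times> 'a \<times> 'a \<Rightarrow> bool" where
  "is_P3 E p = (case p of (a, b, c) \<Rightarrow>
     a \<noteq> b \<and> b \<noteq> c \<and> a \<noteq> c \<and> {a, b} \<in> E \<and> {b, c} \<in> E)"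

definition P3_verts :: "'a \<times> 'a \<times> 'a \<Rightarrow> 'a set" where
  "P3_verts p = (case p of (a, b, c) \<Rightarrow> {a, b, c})"

definition P3_packing :: "'a set set \<Rightarrow> ('a \<times> 'a \<times> 'a) set \<Rightarrow> bool" where
  "P3_packing E P \<longleftrightarrow> finite P \<and> (\<forall>p\<in>P. is_P3 E p) \<and>
     (\<forall>p\<in>P. \<forall>q\<in>P. p \<noteq> q \<longrightarrow> P3_verts p \<inter> P3_verts q = {})"

definition lambda_P3 :: "'a set \<Rightarrow> 'a set set \<Rightarrow> nat" where
  "lambda_P3 V E = Max (card ` {P. P3_packing E P})"

end

theory Submission
  imports Defs
begin

text \<open>
  Call a 2-edge path whose middle vertex has degree 3 and whose ends have degree at most 2 a cherry.
  If every edge joining two vertices of degree 3 could be deleted and no three consecutive vertices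
  had degree 2, then every vertex of degree at most 2 would be adjacent to a vertex of degree 3.
  Assigning each vertex of degree at most 2 to a cubic neighbour so that in every class at most one
  cubic vertex receives an odd number of them gives enough disjoint cherries, the only exception
  being \<open>K\<^bsub>2,3\<^esub>\<close>, a component with five vertices.

  Deleting an edge can only fail by cutting off a five-vertex piece \<open>A\<close>, attached through a vertex
  \<open>x\<close>. Such a piece contains a 2-edge path avoiding \<open>x\<close>, and also one avoiding both \<open>x\<close> and some
  neighbour \<open>a\<close> of \<open>x\<close>. So \<open>A\<close> may be replaced by a marked leaf \<open>x\<close>: this removes four vertices and
  one path, and an edge \<open>xy\<close> at the marked leaf now counts as a full path, standing for \<open>axy\<close>.
  Three consecutive vertices of degree 2 are contracted away, at the price of one path, unless they
  lie on a 4-cycle or 5-cycle, which is a component or leads to a marked leaf again. The theorem is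
  thus proved by induction for graphs with marked leaves.
\<close>

section \<open>Parity assignments\<close>

definition assignment :: "'a set \<Rightarrow> 'b set \<Rightarrow> ('a \<Rightarrow> 'b set) \<Rightarrow> ('b \<Rightarrow> 'a) \<Rightarrow> bool" where
  "assignment D T N f \<longleftrightarrow> (\<forall>t\<in>T. f t \<in> D \<and> t \<in> N (f t))"

definition load :: "'b set \<Rightarrow> ('b \<Rightarrow> 'a) \<Rightarrow> 'a \<Rightarrow> nat" where
  "load T f y = card {t\<in>T. f t = y}"

text \<open>One element changes owner, so only two loads change, each by one. The inequalities
  between truth values act as exclusive or: the parity is flipped once at \<open>y\<close> and once
  at \<open>z\<close>.\<close>

lemma load_upd:
  assumes "finite T" "t \<in> T" "f t = y" "z \<noteq> y"
  shows "odd (load T (f(t := z)) v) \<longleftrightarrow> (odd (load T f v) \<noteq> (v = y)) \<noteq> (v = z)"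
proof -
  have y: "{s\<in>T. f s = y} = insert t {s\<in>T. (f(t := z)) s = y}"
    and z: "{s\<in>T. (f(t := z)) s = z} = insert t {s\<in>T. f s = z}"
    and o: "v \<noteq> y \<Longrightarrow> v \<noteq> z \<Longrightarrow> {s\<in>T. (f(t := z)) s = v} = {s\<in>T. f s = v}"
    using assms by auto
  have "load T f y = Suc (load T (f(t := z)) y)"
    unfolding load_def by (subst y, subst card_insert_disjoint) (use assms in auto)
  moreover have "load T (f(t := z)) z = Suc (load T f z)"
    unfolding load_def by (subst z, subst card_insert_disjoint) (use assms in auto)
  ultimately show ?thesis
    using o assms(4) by (cases "v = y"; cases "v = z") (auto simp: load_def)
qed

text \<open>
  Moving \<open>t\<close> from one of its two possible owners to the other toggles the parity of both loads, so
  two odd loads in the same class can be made even by reassigning along a path between them.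
\<close>
lemma parity_assignment:
  assumes fin: "finite D" "finite T"
    and two: "\<And>t. t \<in> T \<Longrightarrow> {y\<in>D. t \<in> N y} \<noteq> {} \<and> card {y\<in>D. t \<in> N y} \<le> 2"
    and sub: "\<And>y. y \<in> D \<Longrightarrow> N y \<subseteq> T"
    and conn: "\<And>Q. Q \<subseteq> D \<Longrightarrow> Q \<noteq> {} \<Longrightarrow>
      (\<And>y z. y \<in> Q \<Longrightarrow> z \<in> D \<Longrightarrow> N y \<inter> N z \<noteq> {} \<Longrightarrow> z \<in> Q) \<Longrightarrow> Q = D"
  obtains f where "assignment D T N f" "card {y\<in>D. odd (load T f y)} \<le> 1"
proof -
  let ?O = "\<lambda>f. {y\<in>D. odd (load T f y)}"
  have "\<forall>t\<in>T. \<exists>y. y \<in> D \<and> t \<in> N y" using two by blast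
  then obtain f0 where "assignment D T N f0" unfolding assignment_def by metis
  then obtain f where f: "assignment D T N f"
    and min: "\<And>g. assignment D T N g \<Longrightarrow> card (?O f) \<le> card (?O g)"
    using ex_has_least_nat[of "assignment D T N" f0 "\<lambda>f. card (?O f)"] by blast
  have "y = z" if y: "y \<in> ?O f" and z: "z \<in> ?O f" for y z
  proof (rule ccontr)
    assume ne: "y \<noteq> z"
    \<comment> \<open>\<open>Z\<close> collects the vertices to which the odd load at
      \<open>y\<close> can be shifted. It contains \<open>y\<close> itself through
      \<open>g = f\<close>, because the two flips at \<open>y\<close> cancel.\<close>
    define Z where "Z = {z\<in>D. \<exists>g. assignment D T N g \<and>
      (\<forall>v\<in>D. odd (load T g v) \<longleftrightarrow> (odd (load T f v) \<noteq> (v = y)) \<noteq> (v = z))}"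
    have "Z = D"
    proof (rule conn)
      show "Z \<subseteq> D" by (auto simp: Z_def)
      have "y \<in> Z" using f y by (auto simp: Z_def)
      then show "Z \<noteq> {}" by auto
      fix u w assume u: "u \<in> Z" and w: "w \<in> D" and "N u \<inter> N w \<noteq> {}"
      then obtain t where t: "t \<in> N u" "t \<in> N w" by auto
      obtain g where g: "assignment D T N g"
        "\<And>v. v \<in> D \<Longrightarrow> odd (load T g v) \<longleftrightarrow> (odd (load T f v) \<noteq> (v = y)) \<noteq> (v = u)"
        and uD: "u \<in> D" using u by (auto simp: Z_def)
      have tT: "t \<in> T" using sub uD t by blast
      show "w \<in> Z"
      proof (cases "w = u")
        case False
        \<comment> \<open>\<open>u\<close> and \<open>w\<close> are already two possible owners of
          \<open>t\<close>, and \<open>two\<close> allows no third. Handing \<open>t\<close> over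
          from one to the other flips both parities, which moves the excess from \<open>u\<close> to
          \<open>w\<close>.\<close>
        have "g t \<in> {u, w}"
        proof (rule ccontr)
          assume "g t \<notin> {u, w}"
          then have "card {g t, u, w} = 3" using False by auto
          moreover have "{g t, u, w} \<subseteq> {y\<in>D. t \<in> N y}"
            using g(1) tT t uD w by (auto simp: assignment_def)
          ultimately have "3 \<le> card {y\<in>D. t \<in> N y}"
            using card_mono[of "{y\<in>D. t \<in> N y}" "{g t, u, w}"] fin(1) by simp
          then show False using two[OF tT] by simp
        qed
        define h where "h = g(t := if g t = u then w else u)"
        have "assignment D T N h"
          using g(1) t uD w by (auto simp: h_def assignment_def)
        moreover have "odd (load T h v) \<longleftrightarrow> (odd (load T f v) \<noteq> (v = y)) \<noteq> (v = w)" if "v \<in> D" for v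
          using load_upd[OF fin(2) tT, of g "g t" "if g t = u then w else u" v] g(2)[OF that]
            \<open>g t \<in> {u, w}\<close> False unfolding h_def by (auto split: if_splits)
        ultimately show ?thesis using w by (auto simp: Z_def)
      qed (use u in simp)
    qed
    then have "z \<in> Z" using z by simp
    then obtain g where g: "assignment D T N g"
      "\<And>v. v \<in> D \<Longrightarrow> odd (load T g v) \<longleftrightarrow> (odd (load T f v) \<noteq> (v = y)) \<noteq> (v = z)"
      unfolding Z_def by blast
    \<comment> \<open>Both \<open>y\<close> and \<open>z\<close> are odd under \<open>f\<close>, so
      the flips remove both from the odd set and change nothing else, against the minimality of
      \<open>f\<close>.\<close>
    have "?O g \<subset> ?O f" using g(2) y z ne by auto
    then have "card (?O g) < card (?O f)" using fin(1) by (simp add: psubset_card_mono)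
    then show False using min[OF g(1)] by simp
  qed
  then have "\<forall>y\<in>?O f. \<forall>z\<in>?O f. y = z" by blast
  then have "card (?O f) \<le> 1"
    using card_le_Suc0_iff_eq[of "?O f"] fin(1) by simp
  then show thesis using that f by blast
qed

text \<open>Loads are at most 3, so \<open>card T\<close> is twice \<open>card ?C\<close> plus
  \<open>card ?O\<close>, and counting incidences gives \<open>3 * card D \<le> 2 * card T\<close>.
  With no odd load this suffices. With one odd load \<open>card D + 2 \<le> card T\<close> is
  required, and it fails only for two vertices with the same three neighbours, which
  \<open>inj\<close> excludes.\<close>

lemma cherry_assignment_connected:
  assumes fin: "finite D" "finite T" and ne: "D \<noteq> {}"
    and two: "\<And>t. t \<in> T \<Longrightarrow> {y\<in>D. t \<in> N y} \<noteq> {} \<and> card {y\<in>D. t \<in> N y} \<le> 2"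
    and three: "\<And>y. y \<in> D \<Longrightarrow> N y \<subseteq> T \<and> card (N y) = 3"
    and inj: "inj_on N D"
    and conn: "\<And>Q. Q \<subseteq> D \<Longrightarrow> Q \<noteq> {} \<Longrightarrow>
      (\<And>y z. y \<in> Q \<Longrightarrow> z \<in> D \<Longrightarrow> N y \<inter> N z \<noteq> {} \<Longrightarrow> z \<in> Q) \<Longrightarrow> Q = D"
  shows "\<exists>f. assignment D T N f \<and> card D + card T \<le> 4 * card {y\<in>D. 2 \<le> load T f y}"
proof -
  obtain f where f: "assignment D T N f" and odd: "card {y\<in>D. odd (load T f y)} \<le> 1"
    by (rule parity_assignment[OF fin two _ conn]) (use three in auto)
  let ?C = "{y\<in>D. 2 \<le> load T f y}" and ?O = "{y\<in>D. odd (load T f y)}"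
  have le3: "load T f y \<le> 3" if "y \<in> D" for y
  proof -
    have "finite (N y)" using three[OF that] by (metis card.infinite zero_neq_numeral)
    then show ?thesis unfolding load_def
      using card_mono[of "N y" "{t\<in>T. f t = y}"] f three[OF that] by (auto simp: assignment_def)
  qed
  have "card T = (\<Sum>y\<in>D. load T f y)"
  proof -
    have "f ` T \<subseteq> D" using f by (auto simp: assignment_def)
    from sum.group[OF fin(2,1) this, of "\<lambda>_. 1::nat"] show ?thesis by (simp add: load_def)
  qed
  also have "\<dots> = (\<Sum>y\<in>D. 2 * (if 2 \<le> load T f y then 1 else 0) + (if odd (load T f y) then 1 else 0))"
  proof (rule sum.cong[OF refl])
    fix y assume "y \<in> D"
    then have "load T f y \<in> {0, 1, 2, 3}" using le3[of y] by auto
    then show "load T f y = 2 * (if 2 \<le> load T f y then 1 else 0) + (if odd (load T f y) then 1 else 0)"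
      by auto
  qed
  also have "\<dots> = 2 * card ?C + card ?O"
    using fin by (simp add: sum.distrib sum_distrib_left[symmetric] sum.If_cases Int_def)
  finally have T: "card T = 2 * card ?C + card ?O" .
  have "3 * card D = (\<Sum>y\<in>D. card {t\<in>T. t \<in> N y})"
  proof -
    have "card {t\<in>T. t \<in> N y} = 3" if "y \<in> D" for y
    proof -
      have "{t\<in>T. t \<in> N y} = N y" using three[OF that] by auto
      then show ?thesis using three[OF that] by simp
    qed
    then show ?thesis by simp
  qed
  also have "\<dots> = (\<Sum>t\<in>T. card {y\<in>D. t \<in> N y})"
    using sum_multicount_gen[OF fin, of "\<lambda>y t. t \<in> N y" "\<lambda>t. card {y\<in>D. t \<in> N y}"] by simp
  also have "\<dots> \<le> 2 * card T" using sum_mono[of T "\<lambda>t. card {y\<in>D. t \<in> N y}" "\<lambda>_. 2"] two by auto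
  finally have D: "3 * card D \<le> 2 * card T" .
  show ?thesis
  proof (cases "card ?O = 0")
    case True
    then show ?thesis using T D f by (intro exI[of _ f]) auto
  next
    case False
    then have O: "card ?O = 1" using odd by simp
    have "card D + 2 \<le> card T"
    proof (rule ccontr)
      assume a: "\<not> card D + 2 \<le> card T"
      obtain y where y: "y \<in> D" using ne by auto
      have T3: "3 \<le> card T" using three[OF y] card_mono[OF fin(2)] by metis
      have "card D = 2 \<and> card T = 3" using a D T3 T O by linarith
      then obtain u v where uv: "D = {u, v}" "u \<noteq> v" and cT: "card T = 3" by (auto simp: card_2_iff)
      have "N y = T" if "y \<in> D" for y
        using three[OF that] cT fin(2) by (simp add: card_subset_eq)
      then have "N u = T" "N v = T" using uv by auto
      then show False using inj uv by (auto simp: inj_on_def)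
    qed
    then show ?thesis using T O f by (intro exI[of _ f]) auto
  qed
qed

text \<open>A proper nonempty part \<open>Q\<close> of \<open>D\<close> that shares no neighbours
  with the rest splits off together with its neighbours \<open>T1\<close>. Both parts inherit the
  hypotheses and their assignments are glued. If there is no such part, the connected case
  applies.\<close>

lemma cherry_assignment:
  assumes "finite D" "finite T"
    and "\<And>t. t \<in> T \<Longrightarrow> {y\<in>D. t \<in> N y} \<noteq> {} \<and> card {y\<in>D. t \<in> N y} \<le> 2"
    and "\<And>y. y \<in> D \<Longrightarrow> N y \<subseteq> T \<and> card (N y) = 3"
    and "inj_on N D"
  shows "\<exists>f. assignment D T N f \<and> card D + card T \<le> 4 * card {y\<in>D. 2 \<le> load T f y}"
  using assms
proof (induction "card D" arbitrary: D T rule: less_induct)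
  case less
  note fin = less.prems(1,2) and two = less.prems(3) and three = less.prems(4) and inj = less.prems(5)
  show ?case
  proof (cases "\<exists>Q. Q \<subseteq> D \<and> Q \<noteq> {} \<and> Q \<noteq> D \<and> (\<forall>y\<in>Q. \<forall>z\<in>D. N y \<inter> N z \<noteq> {} \<longrightarrow> z \<in> Q)")
    case False
    show ?thesis
    proof (cases "D = {}")
      case True
      then have "T = {}" using two by auto
      then show ?thesis using True by (auto simp: assignment_def)
    next
      case ne: False
      show ?thesis
      proof (rule cherry_assignment_connected)
        show "finite D" "finite T" "D \<noteq> {}" "inj_on N D" using fin ne inj by auto
        show "\<And>t. t \<in> T \<Longrightarrow> {y\<in>D. t \<in> N y} \<noteq> {} \<and> card {y\<in>D. t \<in> N y} \<le> 2" by (rule two)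
        show "\<And>y. y \<in> D \<Longrightarrow> N y \<subseteq> T \<and> card (N y) = 3" by (rule three)
        fix Q assume "Q \<subseteq> D" "Q \<noteq> {}" "\<And>y z. y \<in> Q \<Longrightarrow> z \<in> D \<Longrightarrow> N y \<inter> N z \<noteq> {} \<Longrightarrow> z \<in> Q"
        then show "Q = D" using False by metis
      qed
    qed
  next
    case True
    then obtain Q where Q: "Q \<subseteq> D" "Q \<noteq> {}" "Q \<noteq> D"
      and cl: "\<And>y z. y \<in> Q \<Longrightarrow> z \<in> D \<Longrightarrow> N y \<inter> N z \<noteq> {} \<Longrightarrow> z \<in> Q" by blast
    define T1 where "T1 = \<Union>(N ` Q)"
    have T1: "T1 \<subseteq> T" using Q three by (auto simp: T1_def)
    have c1: "card Q < card D" "card (D - Q) < card D"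
      using Q fin by (auto intro!: psubset_card_mono)
    have e1: "{y\<in>Q. t \<in> N y} = {y\<in>D. t \<in> N y}" if "t \<in> T1" for t
      using that Q cl by (force simp: T1_def)
    have e2: "{y\<in>D - Q. t \<in> N y} = {y\<in>D. t \<in> N y}" if "t \<in> T - T1" for t
      using that by (auto simp: T1_def)
    have "\<exists>f. assignment Q T1 N f \<and> card Q + card T1 \<le> 4 * card {y\<in>Q. 2 \<le> load T1 f y}"
    proof (rule less.hyps[OF c1(1)])
      fix t assume "t \<in> T1" then show "{y\<in>Q. t \<in> N y} \<noteq> {} \<and> card {y\<in>Q. t \<in> N y} \<le> 2"
        using e1 two T1 by auto
    next
      fix y assume "y \<in> Q" then show "N y \<subseteq> T1 \<and> card (N y) = 3"
        using three Q by (auto simp: T1_def)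
    qed (use Q fin T1 inj in \<open>auto intro: finite_subset inj_on_subset\<close>)
    then obtain f where f: "assignment Q T1 N f" "card Q + card T1 \<le> 4 * card {y\<in>Q. 2 \<le> load T1 f y}"
      by blast
    have "\<exists>f. assignment (D - Q) (T - T1) N f \<and>
      card (D - Q) + card (T - T1) \<le> 4 * card {y\<in>D - Q. 2 \<le> load (T - T1) f y}"
    proof (rule less.hyps[OF c1(2)])
      fix t assume t: "t \<in> T - T1"
      show "{y\<in>D - Q. t \<in> N y} \<noteq> {} \<and> card {y\<in>D - Q. t \<in> N y} \<le> 2"
        unfolding e2[OF t] using two t by auto
    next
      fix y assume y: "y \<in> D - Q"
      then have "N y \<inter> T1 = {}" using cl by (force simp: T1_def)
      then show "N y \<subseteq> T - T1 \<and> card (N y) = 3"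
        using three y by auto
    qed (use fin inj in \<open>auto intro: inj_on_subset\<close>)
    then obtain g where g: "assignment (D - Q) (T - T1) N g"
      "card (D - Q) + card (T - T1) \<le> 4 * card {y\<in>D - Q. 2 \<le> load (T - T1) g y}" by blast
    define h where "h t = (if t \<in> T1 then f t else g t)" for t
    have h: "assignment D T N h" using f(1) g(1) Q by (auto simp: assignment_def h_def)
    \<comment> \<open>\<open>h\<close> sends exactly the elements of \<open>T1\<close> into
      \<open>Q\<close>, so every load is inherited unchanged from its own part.\<close>
    have hQ: "h t \<in> Q \<longleftrightarrow> t \<in> T1" if "t \<in> T" for t
      using f(1) g(1) that by (auto simp: assignment_def h_def)
    have "{t\<in>T. h t = y} = {t\<in>T1. f t = y}" if "y \<in> Q" for y
      using that hQ T1 unfolding h_def by (intro Collect_cong) (metis subsetD)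
    then have l1: "load T h y = load T1 f y" if "y \<in> Q" for y
      using that by (simp add: load_def)
    have "{t\<in>T. h t = y} = {t\<in>T - T1. g t = y}" if "y \<in> D - Q" for y
      using that hQ unfolding h_def by (intro Collect_cong) (metis DiffE DiffI)
    then have l2: "load T h y = load (T - T1) g y" if "y \<in> D - Q" for y
      using that by (simp add: load_def)
    have "{y\<in>D. 2 \<le> load T h y} = {y\<in>Q. 2 \<le> load T1 f y} \<union> {y\<in>D - Q. 2 \<le> load (T - T1) g y}"
    proof -
      have "load T h y = (if y \<in> Q then load T1 f y else load (T - T1) g y)" if "y \<in> D" for y
        using l1 l2 that by auto
      then show ?thesis using Q(1) by (auto split: if_splits)
    qed
    then have "card {y\<in>D. 2 \<le> load T h y} =
      card {y\<in>Q. 2 \<le> load T1 f y} + card {y\<in>D - Q. 2 \<le> load (T - T1) g y}"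
      using fin Q by (simp add: card_Un_disjoint disjoint_iff finite_subset)
    moreover have "card D = card Q + card (D - Q)" "card T = card T1 + card (T - T1)"
      using card_Un_disjoint[of Q "D - Q"] card_Un_disjoint[of T1 "T - T1"] Q(1) T1 fin
      by (simp_all add: Un_absorb1 finite_subset[OF Q(1)] finite_subset[OF T1])
    ultimately show ?thesis using h f(2) g(2) by (intro exI[of _ h]) auto
  qed
qed

section \<open>Graphs with marked leaves\<close>

definition nb :: "'a set set \<Rightarrow> 'a \<Rightarrow> 'a set" where
  "nb E v = {w. {v, w} \<in> E}"

lemma in_nb_iff: "w \<in> nb E v \<longleftrightarrow> {v, w} \<in> E"
  by (simp add: nb_def)

lemma nb_sym: "w \<in> nb E v \<longleftrightarrow> v \<in> nb E w"
  by (simp add: nb_def insert_commute)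

lemma nb_symD: "w \<in> nb E v \<Longrightarrow> v \<in> nb E w"
  by (simp add: nb_sym)

lemma nb_restrict_eq: "v \<in> W \<Longrightarrow> nb E v \<subseteq> W \<Longrightarrow> nb (E \<inter> Pow W) v = nb E v"
  by (auto simp: nb_def)

lemma nb_restrict: "v \<in> W \<Longrightarrow> nb (E \<inter> Pow W) v = nb E v \<inter> W"
  by (auto simp: nb_def)

lemma nb_subset:
  assumes "simple_graph V E"
  shows "nb E v \<subseteq> V - {v}"
proof
  fix w assume "w \<in> nb E v"
  then have "{v, w} \<subseteq> V \<and> card {v, w} = 2" using assms unfolding simple_graph_def nb_def by blast
  then show "w \<in> V - {v}" by (cases "w = v") auto
qed

lemma finite_nb: "simple_graph V E \<Longrightarrow> finite (nb E v)"
  using finite_subset[OF nb_subset[of V E v]] by (simp add: simple_graph_def)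

lemma finite_edges: "simple_graph V E \<Longrightarrow> finite E"
  by (rule finite_subset[of E "Pow V"]) (auto simp: simple_graph_def)

lemma degree_eq_card_nb:
  assumes "simple_graph V E"
  shows "degree E v = card (nb E v)"
proof -
  have "{e\<in>E. v \<in> e} = (\<lambda>w. {v, w}) ` nb E v"
  proof (intro set_eqI iffI)
    fix e assume e: "e \<in> {e\<in>E. v \<in> e}"
    then have "card e = 2" using assms by (auto simp: simple_graph_def)
    then obtain a b where ab: "e = {a, b}" by (auto simp: card_2_iff)
    then have "v = a \<or> v = b" using e by auto
    then obtain w where "e = {v, w}" using ab insert_commute[of a b "{}"] by blast
    then show "e \<in> (\<lambda>w. {v, w}) ` nb E v" using e by (auto simp: nb_def)
  next
    fix e assume "e \<in> (\<lambda>w. {v, w}) ` nb E v"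
    then show "e \<in> {e\<in>E. v \<in> e}" by (auto simp: nb_def)
  qed
  moreover have "inj_on (\<lambda>w. {v, w}) (nb E v)" by (auto simp: inj_on_def doubleton_eq_iff)
  ultimately show ?thesis by (simp add: degree_def card_image)
qed

section \<open>Closed sets, pieces and packings\<close>

definition closed_in :: "'a set set \<Rightarrow> 'a set \<Rightarrow> bool" where
  "closed_in E C \<longleftrightarrow> (\<forall>u\<in>C. nb E u \<subseteq> C)"

text \<open>Only the vertex set of a path is kept. An edge at a marked leaf counts as much as a
  path, since the collapsed part behind the leaf supplies the third vertex.\<close>

definition piece :: "'a set set \<Rightarrow> 'a set \<Rightarrow> 'a set \<Rightarrow> bool" where
  "piece E M S \<longleftrightarrow> (\<exists>a b c. distinct [a, b, c] \<and> {a, b} \<in> E \<and> {b, c} \<in> E \<and> S = {a, b, c}) \<or>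
     (\<exists>x\<in>M. \<exists>y. {x, y} \<in> E \<and> S = {x, y})"

definition packs :: "'a set set \<Rightarrow> 'a set \<Rightarrow> 'a set \<Rightarrow> nat \<Rightarrow> bool" where
  "packs E M W m \<longleftrightarrow> (\<exists>F. finite F \<and> card F = m \<and> pairwise disjnt F \<and> (\<forall>S\<in>F. piece E M S \<and> S \<subseteq> W))"

lemma piece_path:
  assumes "a \<in> nb E b" "c \<in> nb E b" "distinct [a, b, c]"
  shows "piece E M {a, b, c}"
proof -
  have "{a, b} \<in> E" "{b, c} \<in> E" using assms(1,2) by (simp_all add: nb_def insert_commute)
  then show ?thesis using assms(3) unfolding piece_def by blast
qed

lemma piece_mark: "x \<in> M \<Longrightarrow> y \<in> nb E x \<Longrightarrow> piece E M {x, y}"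
  by (auto simp: piece_def nb_def)

lemma piece_nonempty: "piece E M S \<Longrightarrow> S \<noteq> {}"
  by (auto simp: piece_def)

lemma piece_mono: "piece E M S \<Longrightarrow> E \<subseteq> E' \<Longrightarrow> M \<subseteq> M' \<Longrightarrow> piece E' M' S"
  unfolding piece_def by blast

lemma packs_mono:
  assumes "packs E M W m" "E \<subseteq> E'" "M \<subseteq> M'" "W \<subseteq> W'"
  shows "packs E' M' W' m"
proof -
  obtain F where F: "finite F" "card F = m" "pairwise disjnt F" "\<forall>S\<in>F. piece E M S \<and> S \<subseteq> W"
    using assms(1) unfolding packs_def by blast
  have "piece E' M' S \<and> S \<subseteq> W'" if "S \<in> F" for S
    using F(4) that piece_mono[OF _ assms(2,3), of S] assms(4) by blast
  then show ?thesis unfolding packs_def using F(1,2,3) by blast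
qed

lemma packs_Un:
  assumes "packs E M W m" "packs E M W' n" "W \<inter> W' = {}"
  shows "packs E M (W \<union> W') (m + n)"
proof -
  obtain F where F: "finite F" "card F = m" "pairwise disjnt F" "\<And>S. S \<in> F \<Longrightarrow> piece E M S \<and> S \<subseteq> W"
    using assms(1) by (auto simp: packs_def)
  obtain G where G: "finite G" "card G = n" "pairwise disjnt G" "\<And>S. S \<in> G \<Longrightarrow> piece E M S \<and> S \<subseteq> W'"
    using assms(2) by (auto simp: packs_def)
  have d: "disjnt S T" if "S \<in> F" "T \<in> G" for S T
    using F(4)[OF that(1)] G(4)[OF that(2)] assms(3) by (auto simp: disjnt_def)
  have "F \<inter> G = {}"
    using d F(4) piece_nonempty by (metis disjnt_self_iff_empty disjoint_iff)
  then have "card (F \<union> G) = m + n" using F G by (simp add: card_Un_disjoint)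
  moreover have "pairwise disjnt (F \<union> G)"
    using F(3) G(3) d by (auto simp: pairwise_def disjnt_sym)
  ultimately show ?thesis unfolding packs_def using F G by (intro exI[of _ "F \<union> G"]) auto
qed

lemma packs_one: "piece E M S \<Longrightarrow> S \<subseteq> W \<Longrightarrow> packs E M W 1"
  unfolding packs_def by (intro exI[of _ "{S}"]) auto

lemma packs_two:
  assumes "piece E M S" "piece E M T" "S \<inter> T = {}" "S \<union> T \<subseteq> W"
  shows "packs E M W 2"
proof -
  have "packs E M (S \<union> T) (1 + 1)"
    by (rule packs_Un[OF packs_one[OF assms(1) subset_refl] packs_one[OF assms(2) subset_refl] assms(3)])
  then show ?thesis using packs_mono[OF _ subset_refl subset_refl assms(4)]
    unfolding one_add_one by blast
qed

text \<open>Only one member of a disjoint family can contain \<open>x\<close>, so at most one fails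
  to be a piece of \<open>E\<close>. If one fails, it is traded for \<open>T1\<close> and
  \<open>T2\<close>; if none does, \<open>T0\<close> is added. Either way one piece is
  gained.\<close>

lemma packs_exchange:
  assumes "packs E' M' W m" and WN: "W \<inter> N = {}" and T0: "piece E M T0" "T0 \<subseteq> N"
    and bad: "\<And>S. piece E' M' S \<Longrightarrow> S \<subseteq> W \<Longrightarrow> \<not> piece E M S \<Longrightarrow>
      x \<in> S \<and> (\<exists>T1 T2. piece E M T1 \<and> piece E M T2 \<and> T1 \<inter> T2 = {} \<and> T1 \<union> T2 \<subseteq> S \<union> N)"
  shows "packs E M (W \<union> N) (Suc m)"
proof -
  obtain F where F: "finite F" "card F = m" "pairwise disjnt F" "\<And>S. S \<in> F \<Longrightarrow> piece E' M' S \<and> S \<subseteq> W"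
    using assms(1) by (auto simp: packs_def)
  show ?thesis
  proof (cases "\<exists>S\<in>F. \<not> piece E M S")
    case False
    then have "\<forall>S\<in>F. piece E M S \<and> S \<subseteq> W" using F(4) by blast
    then have "packs E M W m" unfolding packs_def using F(1,2,3) by blast
    from packs_Un[OF this packs_one[OF T0] WN] show ?thesis by simp
  next
    case True
    then obtain S where S: "S \<in> F" "\<not> piece E M S" by blast
    then obtain T1 T2 where T: "x \<in> S" "piece E M T1" "piece E M T2" "T1 \<inter> T2 = {}" "T1 \<union> T2 \<subseteq> S \<union> N"
      using bad[of S] F(4)[OF S(1)] by metis
    have rest: "piece E M U \<and> U \<subseteq> W - S" if "U \<in> F - {S}" for U
    proof -
      have "U \<inter> S = {}" using that F(3) S(1) by (auto simp: pairwise_def disjnt_def)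
      then show ?thesis using bad[of U] T(1) F(4)[of U] that by blast
    qed
    have "packs E M (W - S) (m - 1)"
      unfolding packs_def
    proof (intro exI conjI)
      show "finite (F - {S})" "card (F - {S}) = m - 1" using F(1,2) S(1) by auto
      show "pairwise disjnt (F - {S})" using F(3) by (rule pairwise_subset) auto
      show "\<forall>U\<in>F - {S}. piece E M U \<and> U \<subseteq> W - S" using rest by blast
    qed
    moreover have "packs E M (S \<union> N) 2" by (rule packs_two[OF T(2-5)])
    moreover have "(W - S) \<inter> (S \<union> N) = {}" using WN by auto
    ultimately have "packs E M ((W - S) \<union> (S \<union> N)) (m - 1 + 2)" by (rule packs_Un)
    moreover have "(W - S) \<union> (S \<union> N) = W \<union> N" using F(4)[OF S(1)] by auto
    \<comment> \<open>\<open>S\<close> belongs to \<open>F\<close>, so \<open>m\<close> is positive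
      and the truncated subtraction is exact.\<close>
    moreover have "m - 1 + 2 = Suc m" using F(1,2) S(1) by (cases m) auto
    ultimately show ?thesis by simp
  qed
qed

lemma card_2_other: "card N = 2 \<Longrightarrow> a \<in> N \<Longrightarrow> \<exists>b. N = {a, b} \<and> b \<noteq> a"
  by (auto simp: card_2_iff)

lemma card_3_other: "card N = 3 \<Longrightarrow> a \<in> N \<Longrightarrow> b \<in> N \<Longrightarrow> a \<noteq> b \<Longrightarrow> \<exists>c. N = {a, b, c} \<and> c \<noteq> a \<and> c \<noteq> b"
  by (auto simp: card_3_iff)

definition marked_graph :: "'a set \<Rightarrow> 'a set set \<Rightarrow> 'a set \<Rightarrow> bool" where
  "marked_graph V E M \<longleftrightarrow> simple_graph V E \<and> M \<subseteq> V \<and> (\<forall>v\<in>M. card (nb E v) = 1) \<and>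
     (\<forall>v\<in>V - M. card (nb E v) = 2 \<or> card (nb E v) = 3)"

text \<open>
  Since degrees are at least 2, no closed unmarked set has fewer than three vertices; hence a closed unmarked
  set of five vertices is automatically a component.
\<close>
definition no_closed_five :: "'a set \<Rightarrow> 'a set set \<Rightarrow> 'a set \<Rightarrow> bool" where
  "no_closed_five V E M \<longleftrightarrow> (\<forall>C. C \<subseteq> V - M \<longrightarrow> closed_in E C \<longrightarrow> card C \<noteq> 5)"

definition quarter_packed :: "'a set \<Rightarrow> 'a set set \<Rightarrow> 'a set \<Rightarrow> bool" where
  "quarter_packed V E M \<longleftrightarrow> (\<exists>m. packs E M V m \<and> card V \<le> 4 * m)"

lemma simple_graph_restrict: "simple_graph V E \<Longrightarrow> W \<subseteq> V \<Longrightarrow> simple_graph W (E \<inter> Pow W)"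
  unfolding simple_graph_def by (auto intro: finite_subset)

section \<open>A minimal counterexample\<close>

text \<open>Size is measured by \<open>card V + card E\<close> because one of the reductions deletes
  only an edge and keeps all vertices.\<close>

locale critical =
  fixes V :: "'a set" and E :: "'a set set" and M :: "'a set"
  assumes graph: "marked_graph V E M" and no_five: "no_closed_five V E M"
    and smaller: "\<And>(V' :: 'a set) E' M'. marked_graph V' E' M' \<Longrightarrow> no_closed_five V' E' M' \<Longrightarrow>
      card V' + card E' < card V + card E \<Longrightarrow> quarter_packed V' E' M'"
    and not_packed: "\<not> quarter_packed V E M"
begin

lemma simple: "simple_graph V E"
  and M_sub: "M \<subseteq> V"
  and mark_card: "v \<in> M \<Longrightarrow> card (nb E v) = 1"
  and unmarked_card: "v \<in> V \<Longrightarrow> v \<notin> M \<Longrightarrow> card (nb E v) = 2 \<or> card (nb E v) = 3"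
  using graph by (auto simp: marked_graph_def)

lemma no_fiveD: "C \<subseteq> V - M \<Longrightarrow> closed_in E C \<Longrightarrow> card C = 5 \<Longrightarrow> False"
  using no_five unfolding no_closed_five_def by blast

lemma finite_V: "finite V"
  using simple by (simp add: simple_graph_def)

lemma nb_V: "w \<in> nb E v \<Longrightarrow> w \<in> V \<and> v \<in> V \<and> w \<noteq> v"
  using nb_subset[OF simple] nb_sym by fast

lemma smaller_restrict:
  assumes "W \<subset> V" "marked_graph W (E \<inter> Pow W) M'" "no_closed_five W (E \<inter> Pow W) M'"
  shows "quarter_packed W (E \<inter> Pow W) M'"
proof (rule smaller[OF assms(2,3)])
  have "card W < card V" using assms(1) finite_V by (simp add: psubset_card_mono)
  moreover have "card (E \<inter> Pow W) \<le> card E" using finite_edges[OF simple] by (simp add: card_mono)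
  ultimately show "card W + card (E \<inter> Pow W) < card V + card E" by simp
qed

section \<open>Removing packed sets and collapsing five-vertex pieces\<close>

lemma not_packs: "packs E M V m \<Longrightarrow> card V \<le> 4 * m \<Longrightarrow> False"
  using not_packed by (auto simp: quarter_packed_def)

text \<open>Deleting a closed set changes no degree elsewhere, so \<open>V - S\<close> is packed by
  minimality, and the \<open>m\<close> pieces inside \<open>S\<close> would complete a packing of
  \<open>V\<close>.\<close>

lemma no_closed_packed:
  assumes S: "S \<subseteq> V" "S \<noteq> {}" "closed_in E S" and p: "packs E M S m" "card S \<le> 4 * m"
  shows False
proof -
  let ?W = "V - S"
  have nb: "nb (E \<inter> Pow ?W) v = nb E v" if "v \<in> ?W" for v
  proof (rule nb_restrict_eq[OF that])
    have "nb E v \<inter> S = {}" using that S(3) nb_symD[of _ E v] by (auto simp: closed_in_def)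
    then show "nb E v \<subseteq> ?W" using nb_V[of _ v] by auto
  qed
  have "marked_graph ?W (E \<inter> Pow ?W) (M - S)"
    unfolding marked_graph_def
    using simple_graph_restrict[OF simple, of ?W] M_sub mark_card unmarked_card
    by (auto simp: subset_iff nb[unfolded Diff_iff])
  moreover have "no_closed_five ?W (E \<inter> Pow ?W) (M - S)"
    unfolding no_closed_five_def
  proof (intro allI impI)
    fix C assume C: "C \<subseteq> ?W - (M - S)" "closed_in (E \<inter> Pow ?W) C"
    then have "nb (E \<inter> Pow ?W) v = nb E v" if "v \<in> C" for v using nb that by auto
    then have "closed_in E C" using C(2) by (auto simp: closed_in_def)
    moreover have "C \<subseteq> V - M" using C(1) by auto
    ultimately show "card C \<noteq> 5" using no_fiveD by metis
  qed
  ultimately have "quarter_packed ?W (E \<inter> Pow ?W) (M - S)"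
    using S by (intro smaller_restrict) auto
  then obtain k where k: "packs (E \<inter> Pow ?W) (M - S) ?W k" "card ?W \<le> 4 * k"
    by (auto simp: quarter_packed_def)
  have "packs E M ?W k" by (rule packs_mono[OF k(1)]) auto
  then have "packs E M (S \<union> ?W) (m + k)" using p(1) by (intro packs_Un) auto
  moreover have "S \<union> ?W = V" using S by auto
  moreover have "card V = card S + card ?W"
    using S(1) finite_V by (metis card_Diff_subset card_mono finite_subset le_add_diff_inverse)
  ultimately show False using not_packs[of "m + k"] p(2) k(2) by simp
qed

text \<open>
  If deleting \<open>S\<close> creates a five-vertex component at \<open>w\<close>, its single path is paid for together
  with \<open>S\<close>; this is why the bound on \<open>card S\<close> is strict.
\<close>
lemma no_pendant_packed:
  assumes S: "S \<subseteq> V" "s \<in> S" "\<And>u. u \<in> S \<Longrightarrow> nb E u \<subseteq> insert w S"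
    and w: "w \<notin> S" "nb E w \<inter> S = {s}" "card (nb E w) = 3"
    and p: "packs E M S m" "card S < 4 * m"
  shows False
proof -
  let ?W = "V - S"
  have wV: "w \<in> V" using w nb_V by auto
  have wM: "w \<notin> M" using w mark_card by force
  have nb: "nb (E \<inter> Pow ?W) v = nb E v" if "v \<in> ?W" "v \<noteq> w" for v
  proof -
    have "nb E v \<inter> S = {}" using that S(3) nb_symD[of _ E v] by blast
    then have "nb E v \<subseteq> ?W" using nb_V[of _ v] by auto
    then show ?thesis using that by (simp add: nb_restrict_eq)
  qed
  have nbw: "nb (E \<inter> Pow ?W) w = nb E w - {s}"
    using w nb_V[of _ w] wV by (auto simp: nb_restrict)
  have cw: "card (nb (E \<inter> Pow ?W) w) = 2"
    unfolding nbw using w by (subst card_Diff_singleton) auto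
  have g: "marked_graph ?W (E \<inter> Pow ?W) (M - S)"
    unfolding marked_graph_def
  proof (intro conjI ballI)
    show "simple_graph ?W (E \<inter> Pow ?W)" by (rule simple_graph_restrict[OF simple]) auto
    show "M - S \<subseteq> ?W" using M_sub by auto
    show "card (nb (E \<inter> Pow ?W) v) = 1" if "v \<in> M - S" for v
      using that wM M_sub mark_card by (subst nb) auto
    show "card (nb (E \<inter> Pow ?W) v) = 2 \<or> card (nb (E \<inter> Pow ?W) v) = 3" if "v \<in> ?W - (M - S)" for v
      using that unmarked_card cw nb by (cases "v = w") auto
  qed
  show False
  proof (cases "no_closed_five ?W (E \<inter> Pow ?W) (M - S)")
    case True
    then have "quarter_packed ?W (E \<inter> Pow ?W) (M - S)"
      using S g by (intro smaller_restrict) auto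
    then obtain k where k: "packs (E \<inter> Pow ?W) (M - S) ?W k" "card ?W \<le> 4 * k"
      by (auto simp: quarter_packed_def)
    have "packs E M ?W k" by (rule packs_mono[OF k(1)]) auto
    then have "packs E M (S \<union> ?W) (m + k)" using p(1) by (intro packs_Un) auto
    moreover have "S \<union> ?W = V" using S by auto
    moreover have "card V = card S + card ?W"
      using S(1) finite_V by (metis card_Diff_subset card_mono finite_subset le_add_diff_inverse)
    ultimately show False using not_packs[of "m + k"] p(2) k(2) by simp
  next
    case False
    then obtain C where C: "C \<subseteq> ?W" "C \<inter> M = {}" "closed_in (E \<inter> Pow ?W) C" "card C = 5"
      by (auto simp: no_closed_five_def)
    have nbC: "nb E v \<subseteq> C" if "v \<in> C" "v \<noteq> w" for v
    proof -
      have "nb (E \<inter> Pow ?W) v = nb E v" using that C(1) by (intro nb) auto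
      then show ?thesis using C(3) that by (auto simp: closed_in_def)
    qed
    \<comment> \<open>Among the vertices of \<open>C\<close> only \<open>w\<close> has lost a
      neighbour; without \<open>w\<close>, the set \<open>C\<close> would have been closed in
      \<open>E\<close> already.\<close>
    have "w \<in> C"
    proof (rule ccontr)
      assume "w \<notin> C"
      then have "closed_in E C" using nbC by (auto simp: closed_in_def)
      moreover have "C \<subseteq> V - M" using C(1,2) by auto
      ultimately show False using C(4) no_fiveD by metis
    qed
    have wC: "nb E w \<subseteq> insert s C"
      using C(3) \<open>w \<in> C\<close> nbw by (auto simp: closed_in_def)
    have "closed_in E (S \<union> C)"
      unfolding closed_in_def using nbC wC S \<open>w \<in> C\<close> by blast
    moreover have "packs E M C 1"
    proof -
      obtain a b where ab: "nb (E \<inter> Pow ?W) w = {a, b}" "a \<noteq> b" using cw by (auto simp: card_2_iff)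
      then have "a \<in> nb E w" "b \<in> nb E w" "a \<in> C" "b \<in> C"
        using nbw C(3) \<open>w \<in> C\<close> by (auto simp: closed_in_def)
      then show ?thesis using \<open>w \<in> C\<close> ab nb_V
        by (intro packs_one[of _ _ "{a, w, b}"] piece_path) auto
    qed
    then have "packs E M (S \<union> C) (m + 1)" using p(1) C by (intro packs_Un) auto
    moreover have "card (S \<union> C) = card S + 5"
      using C S finite_V by (subst card_Un_disjoint) (auto intro: finite_subset)
    ultimately show False using no_closed_packed[of "S \<union> C" "m + 1"] S C p(2) by auto
  qed
qed

text \<open>Here \<open>A\<close> collapses to a marked leaf \<open>x\<close>.\<close>
lemma no_markable:
  assumes A: "A \<subseteq> V - M" "card A = 5" and x: "x \<in> A" "nb E x \<subseteq> insert z A" "z \<in> nb E x" "z \<notin> A"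
    and inner: "\<And>v. v \<in> A \<Longrightarrow> v \<noteq> x \<Longrightarrow> nb E v \<subseteq> A"
    and a: "a \<in> A" "a \<in> nb E x" and T: "piece E M T" "T \<subseteq> A - {x, a}"
  shows False
proof -
  \<comment> \<open>Four vertices disappear, and \<open>x\<close> stays with \<open>z\<close> as its
    only neighbour.\<close>
  let ?W = "V - (A - {x})"
  let ?E = "E \<inter> Pow ?W"
  have xW: "x \<in> ?W" using A x by auto
  have nbx: "nb ?E x = {z}" using x nb_V[of z x] nb_V[of x x] xW by (auto simp: nb_restrict)
  have nb: "nb ?E v = nb E v" if "v \<in> ?W" "v \<noteq> x" for v
  proof -
    have "nb E v \<inter> (A - {x}) = {}" using that inner nb_symD[of _ E v] by blast
    then have "nb E v \<subseteq> ?W" using nb_V[of _ v] by auto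
    then show ?thesis using that by (simp add: nb_restrict_eq)
  qed
  have "marked_graph ?W ?E (insert x M)"
    unfolding marked_graph_def
  proof (intro conjI ballI)
    show "simple_graph ?W ?E" by (rule simple_graph_restrict[OF simple]) auto
    show "insert x M \<subseteq> ?W" using M_sub A xW by auto
    show "card (nb ?E v) = 1" if "v \<in> insert x M" for v
    proof (cases "v = x")
      case False
      then have "v \<in> ?W" "v \<in> M" using that A M_sub by auto
      then show ?thesis using nb False mark_card by simp
    qed (simp add: nbx)
    show "card (nb ?E v) = 2 \<or> card (nb ?E v) = 3" if "v \<in> ?W - insert x M" for v
      using that nb[of v] unmarked_card[of v] by auto
  qed
  moreover have "no_closed_five ?W ?E (insert x M)"
    unfolding no_closed_five_def
  proof (intro allI impI)
    fix C assume C: "C \<subseteq> ?W - insert x M" "closed_in ?E C"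
    then have "nb ?E v = nb E v" if "v \<in> C" for v using nb[of v] that by auto
    then have "closed_in E C" using C(2) by (auto simp: closed_in_def)
    moreover have "C \<subseteq> V - M" using C(1) by auto
    ultimately show "card C \<noteq> 5" using no_fiveD by metis
  qed
  moreover have "A - {x} \<noteq> {}" using a nb_V by auto
  then have "?W \<subset> V" using A by auto
  ultimately have "quarter_packed ?W ?E (insert x M)" by (intro smaller_restrict)
  then obtain k where k: "packs ?E (insert x M) ?W k" "card ?W \<le> 4 * k"
    by (auto simp: quarter_packed_def)
  have "packs E M (?W \<union> (A - {x})) (Suc k)"
  proof (rule packs_exchange[OF k(1), of _ _ _ T x])
    fix S assume S: "piece ?E (insert x M) S" "S \<subseteq> ?W" "\<not> piece E M S"
    \<comment> \<open>Since \<open>?E\<close> lies inside \<open>E\<close>, only an edge at the new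
      mark can fail to be a piece, and that edge is \<open>{x, z}\<close>. It is traded for the path
      \<open>z\<close>, \<open>x\<close>, \<open>a\<close> and for \<open>T\<close>, which avoids
      both \<open>x\<close> and \<open>a\<close>.\<close>
    have "\<not> (\<exists>a b c. distinct [a, b, c] \<and> {a, b} \<in> ?E \<and> {b, c} \<in> ?E \<and> S = {a, b, c})"
      using S(3) unfolding piece_def by blast
    then obtain u v where uv: "u \<in> insert x M" "v \<in> nb ?E u" "S = {u, v}"
      using S(1) unfolding piece_def in_nb_iff by blast
    then have "u \<notin> M" using S(3) piece_mark[of u M v E] by (auto simp: nb_def)
    then have "S = {x, z}" using uv nbx by auto
    moreover have "piece E M {z, x, a}" using x a nb_V[of a x] nb_V[of z x]
      by (intro piece_path) auto
    ultimately show "x \<in> S \<and> (\<exists>T1 T2. piece E M T1 \<and> piece E M T2 \<and> T1 \<inter> T2 = {} \<and> T1 \<union> T2 \<subseteq> S \<union> (A - {x}))"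
      using T a x nb_V[of a x] by (intro conjI exI[of _ "{z, x, a}"] exI[of _ T]) auto
  qed (use T in auto)
  moreover have "?W \<union> (A - {x}) = V" using A by auto
  moreover have "card V = card ?W + 4"
  proof -
    have "card (A - {x}) = 4" "A - {x} \<subseteq> V" using A x by auto
    then show ?thesis using finite_V
      by (metis card_Diff_subset card_mono finite_subset le_add_diff_inverse2)
  qed
  ultimately show False using not_packs[of "Suc k"] k(2) by simp
qed

section \<open>No two cubic vertices are adjacent\<close>

lemma unmarked_two_nb:
  assumes "v \<in> V" "v \<notin> M"
  obtains a b where "a \<noteq> b" "a \<in> nb E v" "b \<in> nb E v"
proof -
  have "card (nb E v) = 2 \<or> card (nb E v) = 3" using unmarked_card assms by blast
  then have "2 \<le> card (nb E v)" by auto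
  then obtain X where "X \<subseteq> nb E v" "card X = 2" by (meson obtain_subset_with_card_n)
  then show thesis using that by (auto simp: card_2_iff)
qed

text \<open>Besides \<open>x\<close> and its two neighbours \<open>a\<close>, \<open>b\<close>
  inside, \<open>C\<close> has two vertices \<open>c\<close>, \<open>d\<close>. If \<open>c\<close>
  and \<open>d\<close> are adjacent, they extend to a path by one of \<open>a\<close>,
  \<open>b\<close>, avoiding the other. If not, their degrees force both to be adjacent to
  \<open>a\<close> and \<open>b\<close>, and \<open>c\<close>, \<open>b\<close>, \<open>d\<close> is
  a path avoiding \<open>a\<close>. Hence \<open>C\<close> can be collapsed to a marked
  leaf.\<close>

lemma no_bridge_to_five:
  assumes x: "card (nb E x) = 3" "y \<in> nb E x" and C: "C \<subseteq> V - M" "card C = 5" "x \<in> C" "y \<notin> C"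
    and inner: "\<And>v. v \<in> C \<Longrightarrow> v \<noteq> x \<Longrightarrow> nb E v \<subseteq> C" and nbx: "nb E x \<subseteq> insert y C"
  shows False
proof -
  have "card (nb E x - {y}) = 2" using x by (subst card_Diff_singleton) auto
  then obtain a b where ab: "nb E x - {y} = {a, b}" "a \<noteq> b" by (auto simp: card_2_iff)
  have abC: "a \<in> C" "b \<in> C" "a \<in> nb E x" "b \<in> nb E x" using ab nbx by auto
  then have abx: "a \<noteq> x" "b \<noteq> x" using nb_V by auto
  have "finite C" using C finite_V by (auto intro: finite_subset)
  then have "card (C - {x, a, b}) = 2" using C abC abx ab by (subst card_Diff_subset) auto
  then obtain c d where cd: "C - {x, a, b} = {c, d}" "c \<noteq> d" by (auto simp: card_2_iff)
  have "C = {x, a, b} \<union> (C - {x, a, b})" using C abC by blast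
  then have Ceq: "C = {x, a, b, c, d}" unfolding cd by auto
  have "c \<in> C - {x, a, b}" "d \<in> C - {x, a, b}" unfolding cd by auto
  then have dist: "distinct [x, a, b, c, d]" using abx ab(2) cd(2) by auto
  have cx: "nb E c \<subseteq> {a, b, d}" "nb E d \<subseteq> {a, b, c}"
  proof -
    have "nb E x \<subseteq> {a, b, y}" using ab(1) by blast
    moreover have "y \<noteq> c" "y \<noteq> d" using C(4) unfolding Ceq by auto
    ultimately have "c \<notin> nb E x" "d \<notin> nb E x" using dist by auto
    then have "x \<notin> nb E c" "x \<notin> nb E d" using nb_symD by metis+
    moreover have "c \<notin> nb E c" "d \<notin> nb E d" using nb_V by blast+
    moreover have "nb E c \<subseteq> {x, a, b, c, d}" "nb E d \<subseteq> {x, a, b, c, d}"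
      using inner[of c] inner[of d] dist unfolding Ceq by auto
    ultimately show "nb E c \<subseteq> {a, b, d}" "nb E d \<subseteq> {a, b, c}" by auto
  qed
  have two: "\<exists>p q. p \<noteq> q \<and> p \<in> nb E v \<and> q \<in> nb E v" if v: "v \<in> C" for v
    by (rule unmarked_two_nb[of v]) (use v C(1) in auto)
  have "\<exists>e\<in>{a, b}. \<exists>T. piece E M T \<and> T \<subseteq> C - {x, e}"
  proof (cases "d \<in> nb E c")
    case True
    have "c \<in> C" unfolding Ceq by simp
    then obtain e where e: "e \<in> {a, b}" "e \<in> nb E c" using two[of c] cx by blast
    then have P: "piece E M {e, c, d}" using True dist by (intro piece_path) auto
    obtain f where f: "f \<in> {a, b}" "f \<noteq> e" using ab(2) by blast
    have "{e, c, d} \<subseteq> C - {x, f}" using e f dist unfolding Ceq by auto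
    then show ?thesis using P f(1) by blast
  next
    case False
    then have "c \<notin> nb E d" using nb_symD by metis
    then have "nb E c \<subseteq> {a, b}" "nb E d \<subseteq> {a, b}" using cx False by auto
    moreover have "c \<in> C" "d \<in> C" unfolding Ceq by auto
    ultimately have "b \<in> nb E c" "b \<in> nb E d" using two[of c] two[of d] by blast+
    then have "piece E M {c, b, d}" using dist by (intro piece_path) (auto intro: nb_symD)
    moreover have "{c, b, d} \<subseteq> C - {x, a}" using dist unfolding Ceq by auto
    ultimately show ?thesis by blast
  qed
  then obtain e T where e: "e \<in> {a, b}" "piece E M T" "T \<subseteq> C - {x, e}" by blast
  then have "e \<in> C" "e \<in> nb E x" using abC by auto
  then show False using no_markable[OF C(1,2,3) nbx x(2) C(4) inner _ _ e(2,3)] by blast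
qed

text \<open>Deleting the edge leaves degree 2 at both ends, and a packing of the smaller graph is
  one of \<open>E\<close>. The only obstacle is a new closed five-set. If it contains exactly one
  end, the edge is a bridge to it; otherwise it was closed before the deletion.\<close>

lemma cubic_independent:
  assumes "card (nb E x) = 3" "card (nb E y) = 3" "y \<in> nb E x"
  shows False
proof -
  let ?E = "E - {{x, y}}"
  have xy: "x \<noteq> y" "x \<in> V" "y \<in> V" "x \<in> nb E y" using assms nb_V nb_sym by metis+
  have unm: "x \<notin> M" "y \<notin> M" using assms mark_card by force+
  have nx: "nb ?E x = nb E x - {y}" and ny: "nb ?E y = nb E y - {x}"
    and nb: "\<And>v. v \<noteq> x \<Longrightarrow> v \<noteq> y \<Longrightarrow> nb ?E v = nb E v"
    by (auto simp: nb_def doubleton_eq_iff)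
  have cx: "card (nb ?E x) = 2" "card (nb ?E y) = 2"
    unfolding nx ny using assms xy by (simp_all add: card_Diff_singleton)
  have g: "marked_graph V ?E M"
    unfolding marked_graph_def
  proof (intro conjI ballI)
    show "simple_graph V ?E" using simple by (auto simp: simple_graph_def)
    show "M \<subseteq> V" by (rule M_sub)
    show "card (nb ?E v) = 1" if "v \<in> M" for v
      using that nb[of v] unm mark_card[of v] by metis
    show "card (nb ?E v) = 2 \<or> card (nb ?E v) = 3" if "v \<in> V - M" for v
      using that nb[of v] cx unmarked_card[of v] by (metis DiffE)
  qed
  show False
  proof (cases "no_closed_five V ?E M")
    case True
    have "card ?E < card E"
      using finite_edges[OF simple] assms(3) by (intro psubset_card_mono) (auto simp: nb_def)
    then obtain k where "packs ?E M V k" "card V \<le> 4 * k"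
      using smaller[OF g True] by (auto simp: quarter_packed_def)
    then show False using not_packs packs_mono[of ?E M V k E M V] by blast
  next
    case False
    then obtain C where C: "C \<subseteq> V - M" "closed_in ?E C" "card C = 5"
      by (auto simp: no_closed_five_def)
    have i: "nb E v \<subseteq> C" if "v \<in> C" "v \<noteq> x" "v \<noteq> y" for v
      using that C(2) nb[of v] by (auto simp: closed_in_def)
    have ix: "x \<in> C \<Longrightarrow> nb E x \<subseteq> insert y C" and iy: "y \<in> C \<Longrightarrow> nb E y \<subseteq> insert x C"
      using C(2) nx ny by (auto simp: closed_in_def)
    consider "x \<in> C" "y \<notin> C" | "y \<in> C" "x \<notin> C" | "x \<in> C \<longleftrightarrow> y \<in> C" by blast
    then show False
    proof cases
      case 1
      show False by (rule no_bridge_to_five[of x y C]) (use 1 i ix assms C in auto)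
    next
      case 2
      show False by (rule no_bridge_to_five[of y x C]) (use 2 i iy assms C xy in auto)
    next
      case 3
      then have "closed_in E C" unfolding closed_in_def using i ix iy by blast
      then show False using C no_fiveD by metis
    qed
  qed
qed

section \<open>Three consecutive vertices of degree 2\<close>

lemma unmarked_if: "card (nb E v) \<noteq> 1 \<Longrightarrow> v \<notin> M"
  using mark_card by blast

text \<open>
  The segment \<open>p\<close>, \<open>q\<close>, \<open>r\<close> collapses to an edge \<open>xy\<close>. A piece of the smaller graph that uses
  \<open>xy\<close> splits into two pieces, one around each end of the segment.
\<close>
lemma no_contractible:
  assumes nbp: "nb E p = {x, q}" and nbq: "nb E q = {p, r}" and nbr: "nb E r = {q, y}"
    and dist: "distinct [x, p, q, r, y]" and xy: "y \<notin> nb E x"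
  shows False
proof -
  let ?W = "V - {p, q, r}"
  let ?E = "insert {x, y} (E \<inter> Pow ?W)"
  have V: "{p, q, r, x, y} \<subseteq> V" using nb_V nbp nbq nbr by blast
  have unm: "p \<notin> M" "q \<notin> M" "r \<notin> M" using nbp nbq nbr dist by (auto intro!: unmarked_if)
  have px: "p \<in> nb E x" "q \<notin> nb E x" "r \<notin> nb E x"
    using dist by (auto simp: nb_sym[of p E x] nb_sym[of q E x] nb_sym[of r E x] nbp nbq nbr)
  have ry: "r \<in> nb E y" "q \<notin> nb E y" "p \<notin> nb E y"
    using dist by (auto simp: nb_sym[of p E y] nb_sym[of q E y] nb_sym[of r E y] nbp nbq nbr)
  have ins: "nb ?E v = nb (E \<inter> Pow ?W) v \<union> (if v = x then {y} else {}) \<union> (if v = y then {x} else {})" for v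
    using dist by (auto simp: nb_def doubleton_eq_iff)
  have "nb E x \<inter> ?W = nb E x - {p}" "nb E y \<inter> ?W = nb E y - {r}"
    using px ry nb_V[of _ x] nb_V[of _ y] by blast+
  moreover have "x \<in> ?W" "y \<in> ?W" "x \<noteq> y" using V dist by auto
  ultimately have nbx: "nb ?E x = insert y (nb E x - {p})" and nby: "nb ?E y = insert x (nb E y - {r})"
    by (simp_all only: ins nb_restrict) simp_all
  have nb: "nb ?E v = nb E v" if "v \<in> ?W" "v \<noteq> x" "v \<noteq> y" for v
  proof -
    have "p \<notin> nb E v" "q \<notin> nb E v" "r \<notin> nb E v"
      using that by (simp_all add: nb_sym[of p E v] nb_sym[of q E v] nb_sym[of r E v] nbp nbq nbr)
    then have "nb E v \<subseteq> ?W" using nb_V[of _ v] by auto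
    then have "nb (E \<inter> Pow ?W) v = nb E v" by (rule nb_restrict_eq[OF that(1)])
    then show ?thesis using ins[of v] that by simp
  qed
  \<comment> \<open>The degrees of \<open>x\<close> and \<open>y\<close> survive because the new
    edge was not present: \<open>p\<close> is exchanged for \<open>y\<close> at \<open>x\<close>,
    and \<open>r\<close> for \<open>x\<close> at \<open>y\<close>.\<close>
  have card_move: "card (insert b (N - {a})) = card N" if "a \<in> N" "b \<notin> N" "finite N" for a b and N :: "'a set"
    using that by (metis Diff_iff card.remove card_insert_disjoint finite_Diff)
  have cx: "card (nb ?E x) = card (nb E x)" and cy: "card (nb ?E y) = card (nb E y)"
    unfolding nbx nby using xy nb_symD[of x E y]
    by (auto intro: card_move[OF px(1) _ finite_nb[OF simple]] card_move[OF ry(1) _ finite_nb[OF simple]])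
  have card_nb: "card (nb ?E v) = card (nb E v)" if "v \<in> ?W" for v
    using nb[OF that] cx cy by metis
  have graph': "marked_graph ?W ?E M"
    unfolding marked_graph_def
  proof (intro conjI ballI)
    have "simple_graph ?W (E \<inter> Pow ?W)" by (rule simple_graph_restrict[OF simple]) auto
    then show "simple_graph ?W ?E" using V dist by (auto simp: simple_graph_def)
    show "M \<subseteq> ?W" using unm M_sub by auto
    then show "card (nb ?E v) = 1" if "v \<in> M" for v
      using card_nb[of v] mark_card[OF that] that by auto
    show "card (nb ?E v) = 2 \<or> card (nb ?E v) = 3" if "v \<in> ?W - M" for v
      using card_nb[of v] unmarked_card[of v] that by auto
  qed
  have no_five': "no_closed_five ?W ?E M"
    unfolding no_closed_five_def
  proof (intro allI impI notI)
    fix C assume C: "C \<subseteq> ?W - M" "closed_in ?E C" "card C = 5"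
    have CVM: "C \<subseteq> V - M" using C(1) by auto
    have inner: "nb E v \<subseteq> C" if "v \<in> C" "v \<noteq> x" "v \<noteq> y" for v
    proof -
      have "nb ?E v = nb E v" using that C(1) by (intro nb) auto
      then show ?thesis using C(2) that unfolding closed_in_def by metis
    qed
    have xC: "x \<in> C \<Longrightarrow> y \<in> C \<and> nb E x \<subseteq> insert p C" and yC: "y \<in> C \<Longrightarrow> x \<in> C \<and> nb E y \<subseteq> insert r C"
      using C(2) nbx nby unfolding closed_in_def by blast+
    show False
    proof (cases "x \<in> C")
      case False
      then have "closed_in E C" unfolding closed_in_def using inner yC by blast
      then show False using no_fiveD[OF CVM] C(3) by blast
    next
      case True
      then have "y \<in> C" using xC by blast
      \<comment> \<open>Undoing the contraction turns a closed five-set containing the new edge into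
        a closed set of at most eight vertices, which two paths suffice to pack: one is the segment,
        the other is centred at a vertex of \<open>C\<close> other than \<open>x\<close> and
        \<open>y\<close>.\<close>
      have "closed_in E (C \<union> {p, q, r})"
        unfolding closed_in_def
      proof
        fix v assume "v \<in> C \<union> {p, q, r}"
        then consider "v = x" | "v = y" | "v \<in> C" "v \<noteq> x" "v \<noteq> y" | "v = p" | "v = q" | "v = r" by blast
        then show "nb E v \<subseteq> C \<union> {p, q, r}"
          using inner[of v] xC yC True \<open>y \<in> C\<close> by cases (auto simp: nbp nbq nbr)
      qed
      moreover have "packs E M (C \<union> {p, q, r}) 2"
      proof -
        have "\<not> C \<subseteq> {x, y}"
        proof
          assume "C \<subseteq> {x, y}"
          then have "card C \<le> card {x, y}" by (intro card_mono) auto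
          then show False using C(3) dist by simp
        qed
        then obtain v where v: "v \<in> C" "v \<noteq> x" "v \<noteq> y" by blast
        obtain a b where ab: "a \<noteq> b" "a \<in> nb E v" "b \<in> nb E v"
          using unmarked_two_nb[of v] v CVM by blast
        have P: "piece E M {a, v, b}" using ab nb_V[of a v] nb_V[of b v] by (intro piece_path) auto
        have Q: "piece E M {p, q, r}" using nbq dist by (intro piece_path) auto
        have "{a, v, b} \<subseteq> C" using inner[OF v] ab v by auto
        then show ?thesis using C(1) by (intro packs_two[OF P Q]) auto
      qed
      moreover have "card (C \<union> {p, q, r}) \<le> 8"
        using card_Un_le[of C "{p, q, r}"] C(3) dist by simp
      moreover have "C \<union> {p, q, r} \<subseteq> V" using V CVM by auto
      ultimately show False using no_closed_packed[of "C \<union> {p, q, r}" 2] by simp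
    qed
  qed
  have cardW: "card V = card ?W + 3"
  proof -
    have "card {p, q, r} = 3" "{p, q, r} \<subseteq> V" using dist V by auto
    then show ?thesis using finite_V
      by (metis card_Diff_subset card_mono finite_subset le_add_diff_inverse2)
  qed
  \<comment> \<open>A crude bound is enough, since three vertices are lost.\<close>
  have "card ?E \<le> card E + 1"
  proof -
    have "card (E \<inter> Pow ?W) \<le> card E" using finite_edges[OF simple] by (simp add: card_mono)
    then show ?thesis using finite_edges[OF simple] by (simp add: card_insert_if)
  qed
  then have "quarter_packed ?W ?E M" using smaller[OF graph' no_five'] cardW by linarith
  then obtain k where k: "packs ?E M ?W k" "card ?W \<le> 4 * k"
    by (auto simp: quarter_packed_def)
  have "packs E M (?W \<union> {p, q, r}) (Suc k)"
  proof (rule packs_exchange[OF k(1), of _ _ _ "{p, q, r}" x])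
    show "piece E M {p, q, r}" using nbq dist by (intro piece_path) auto
    have xpq: "piece E M {x, p, q}" and qry: "piece E M {q, r, y}"
      using nbp nbr dist by (auto intro!: piece_path)
    fix S assume S: "piece ?E M S" "S \<subseteq> ?W" "\<not> piece E M S"
    \<comment> \<open>Here \<open>b\<close> is the middle of the path and \<open>{a, b}\<close> is
      the new edge. The vertices \<open>b\<close>, \<open>c\<close> are joined by the segment vertex
      next to \<open>b\<close>, and \<open>a\<close> takes the other two segment vertices.\<close>
    have long: "x \<in> S \<and> (\<exists>T1 T2. piece E M T1 \<and> piece E M T2 \<and> T1 \<inter> T2 = {} \<and> T1 \<union> T2 \<subseteq> S \<union> {p, q, r})"
      if bc: "{b, c} \<in> ?E" and d: "distinct [a, b, c]" and ab: "{a, b} = {x, y}" and Sabc: "S = {a, b, c}" for a b c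
    proof -
      have ne: "{b, c} \<noteq> {x, y}" using d ab by (auto simp: doubleton_eq_iff)
      then have "{b, c} \<in> E" using bc by blast
      then have c: "c \<in> nb E b" by (simp add: nb_def)
      have cW: "c \<in> ?W" using S(2) Sabc by auto
      consider "a = x" "b = y" | "a = y" "b = x" using ab by (auto simp: doubleton_eq_iff)
      then show ?thesis
      proof cases
        case 1
        have "piece E M {r, y, c}" using 1 c ry cW d dist by (intro piece_path) auto
        then show ?thesis using xpq 1 cW Sabc dist d
          by (intro conjI exI[of _ "{x, p, q}"] exI[of _ "{r, y, c}"]) auto
      next
        case 2
        have "piece E M {p, x, c}" using 2 c px cW d dist by (intro piece_path) auto
        then show ?thesis using qry 2 cW Sabc dist d
          by (intro conjI exI[of _ "{p, x, c}"] exI[of _ "{q, r, y}"]) auto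
      qed
    qed
    from S(1) consider (path) a b c where "distinct [a, b, c]" "{a, b} \<in> ?E" "{b, c} \<in> ?E" "S = {a, b, c}"
      | (mark) u v where "u \<in> M" "{u, v} \<in> ?E" "S = {u, v}" unfolding piece_def by blast
    then show "x \<in> S \<and> (\<exists>T1 T2. piece E M T1 \<and> piece E M T2 \<and> T1 \<inter> T2 = {} \<and> T1 \<union> T2 \<subseteq> S \<union> {p, q, r})"
    proof cases
      case path
      have "{a, b} = {x, y} \<or> {c, b} = {x, y}"
      proof (rule ccontr)
        assume "\<not> ?thesis"
        then have "{a, b} \<in> E" "{b, c} \<in> E" using path(2,3) insert_commute[of b c "{}"] by auto
        then show False using S(3) path(1,4) unfolding piece_def by blast
      qed
      then show ?thesis
      proof
        assume "{a, b} = {x, y}"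
        then show ?thesis by (rule long[OF path(3,1) _ path(4)])
      next
        assume cb: "{c, b} = {x, y}"
        have "{b, a} \<in> ?E" "distinct [c, b, a]" "S = {c, b, a}" using path by (auto simp: insert_commute)
        then show ?thesis using long[of b a c] cb by blast
      qed
    next
      \<comment> \<open>The marked end keeps a marked edge, now to its neighbour on the segment; the
        other end forms a path with the remaining two segment vertices.\<close>
      case mark
      have "{u, v} = {x, y}"
      proof (rule ccontr)
        assume "\<not> ?thesis"
        then have "{u, v} \<in> E" using mark(2) by blast
        then show False using S(3) mark(1,3) unfolding piece_def by blast
      qed
      then consider "u = x" "v = y" | "u = y" "v = x" by (auto simp: doubleton_eq_iff)
      then show ?thesis
      proof cases
        case 1
        have "piece E M {x, p}" using mark(1) 1 px by (intro piece_mark) auto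
        then show ?thesis using qry 1 mark(3) dist
          by (intro conjI exI[of _ "{x, p}"] exI[of _ "{q, r, y}"]) auto
      next
        case 2
        have "piece E M {y, r}" using mark(1) 2 ry by (intro piece_mark) auto
        then show ?thesis using xpq 2 mark(3) dist
          by (intro conjI exI[of _ "{x, p, q}"] exI[of _ "{y, r}"]) auto
      qed
    qed
  qed auto
  moreover have "?W \<union> {p, q, r} = V" using V by auto
  ultimately show False using not_packs[of "Suc k"] k(2) cardW by simp
qed

text \<open>The 5-cycle is attached to the rest only through the third neighbour \<open>z\<close> of
  \<open>y\<close>. It collapses to a marked leaf \<open>y\<close>, with \<open>r\<close> as the
  neighbour and \<open>x\<close>, \<open>p\<close>, \<open>q\<close> as the path avoiding
  both.\<close>

lemma no_pendant_pentagon: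
  assumes nbp: "nb E p = {x, q}" and nbq: "nb E q = {p, r}" and nbr: "nb E r = {q, y}"
    and nbx: "nb E x = {p, y}" and y: "x \<in> nb E y" "card (nb E y) = 3" and dist: "distinct [x, p, q, r, y]"
  shows False
proof -
  have r: "r \<in> nb E y" using nb_symD[of y E r] nbr by auto
  have "card (nb E y - {x, r}) = 1" using y r dist by (subst card_Diff_subset) auto
  then obtain z where z: "nb E y - {x, r} = {z}" by (auto simp: card_1_singleton_iff)
  then have zy: "z \<in> nb E y" "z \<noteq> x" "z \<noteq> r" by auto
  have A: "{x, p, q, r, y} \<subseteq> V - M"
  proof -
    have "{x, p, q, r, y} \<subseteq> V" using nb_V nbp nbq nbr by blast
    moreover have "x \<notin> M" "p \<notin> M" "q \<notin> M" "r \<notin> M" "y \<notin> M"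
      using nbp nbq nbr nbx y dist by (auto intro!: unmarked_if)
    ultimately show ?thesis by auto
  qed
  have "z \<notin> {x, p, q, r, y}"
    using zy nb_V[of z y] nb_symD[of z E y] nbp nbq dist
    by (auto simp: doubleton_eq_iff)
  moreover have "nb E y \<subseteq> insert z {x, p, q, r, y}" using z by auto
  moreover have "piece E M {x, p, q}" using nbp dist by (intro piece_path) auto
  moreover have "card {x, p, q, r, y} = 5" using dist by simp
  ultimately show False
    using dist zy(1) r
  proof (intro no_markable[OF A, of y z r "{x, p, q}"])
    show "nb E v \<subseteq> {x, p, q, r, y}" if "v \<in> {x, p, q, r, y}" "v \<noteq> y" for v
      using that nbp nbq nbr nbx by auto
  qed auto
qed

text \<open>If \<open>x\<close> has degree 2, the 4-cycle is closed and packed by one path.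
  Otherwise let \<open>z\<close> be its third neighbour. If \<open>z\<close> is marked, the edge
  \<open>zx\<close> and the path \<open>p\<close>, \<open>q\<close>, \<open>r\<close> pack a closed
  set of five vertices. If not, \<open>z\<close> has degree 2 because cubic vertices are not
  adjacent, and the square together with \<open>z\<close> collapses to a marked leaf
  \<open>z\<close>.\<close>

lemma no_pendant_square:
  assumes nbp: "nb E p = {x, q}" and nbq: "nb E q = {p, r}" and nbr: "nb E r = {q, x}"
    and dist: "distinct [x, p, q, r]"
  shows False
proof -
  have V: "{x, p, q, r} \<subseteq> V" using nb_V nbp nbq nbr by blast
  have unm: "p \<notin> M" "q \<notin> M" "r \<notin> M" using nbp nbq nbr dist by (auto intro!: unmarked_if)
  have px: "p \<in> nb E x" "r \<in> nb E x" by (simp_all add: nb_sym[of p E x] nb_sym[of r E x] nbp nbr)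
  have "x \<notin> M"
  proof
    assume "x \<in> M"
    then obtain u where "nb E x = {u}" using mark_card[of x] by (auto simp: card_1_singleton_iff)
    then show False using px dist by simp
  qed
  then have "card (nb E x) = 2 \<or> card (nb E x) = 3" using unmarked_card V by blast
  have pqr: "piece E M {p, q, r}" using nbq dist by (intro piece_path) auto
  have "card (nb E x) \<noteq> 2"
  proof
    assume "card (nb E x) = 2"
    then have "nb E x = {p, r}" using card_2_other[OF _ px(1)] px(2) dist by fastforce
    then have "closed_in E {x, p, q, r}" using nbp nbq nbr by (auto simp: closed_in_def)
    moreover have "packs E M {x, p, q, r} 1" by (rule packs_one[OF pqr]) auto
    ultimately show False using no_closed_packed[of "{x, p, q, r}" 1] V dist by simp
  qed
  then have x3: "card (nb E x) = 3" using \<open>card (nb E x) = 2 \<or> card (nb E x) = 3\<close> by blast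
  then obtain z where z: "nb E x = {p, r, z}" "z \<noteq> p" "z \<noteq> r"
    using card_3_other[OF _ px] dist by auto
  have zx: "z \<in> nb E x" "x \<in> nb E z" using z by (simp_all add: nb_sym[of x E z])
  have "x \<noteq> z" "z \<in> V" using nb_V[OF zx(1)] by auto
  have "x \<notin> nb E q" using nbq dist by auto
  then have "z \<noteq> q" using zx(2) by auto
  have zd: "z \<notin> {x, p, q, r}" using \<open>x \<noteq> z\<close> \<open>z \<noteq> q\<close> z by auto
  show False
  proof (cases "z \<in> M")
    case True
    then obtain u where "nb E z = {u}" using mark_card[of z] by (auto simp: card_1_singleton_iff)
    then have "nb E z = {x}" using zx by simp
    then have "closed_in E {x, p, q, r, z}" using nbp nbq nbr z by (auto simp: closed_in_def)
    moreover have "piece E M {z, x}" using True zx by (intro piece_mark) auto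
    then have "packs E M {x, p, q, r, z} 2"
      using zd dist by (intro packs_two[OF pqr]) auto
    moreover have "card {x, p, q, r, z} \<le> 8" by (simp add: card_insert_if)
    ultimately show False using no_closed_packed[of "{x, p, q, r, z}" 2] V \<open>z \<in> V\<close> by simp
  next
    case False
    then have "card (nb E z) = 2" using unmarked_card[OF \<open>z \<in> V\<close>] cubic_independent[OF x3 _ zx(1)] by blast
    then obtain w where w: "nb E z = {x, w}" "w \<noteq> x" using card_2_other zx by metis
    have wz: "w \<in> nb E z" "z \<in> nb E w" using w by (simp_all add: nb_sym[of z E w])
    have "w \<notin> {x, p, q, r, z}"
      using w(2) wz(2) nb_V[OF wz(1)] zd nbp nbq nbr by auto
    moreover have "card {x, p, q, r, z} = 5" using zd dist by auto
    moreover have "{x, p, q, r, z} \<subseteq> V - M" using V \<open>z \<in> V\<close> False unm \<open>x \<notin> M\<close> by auto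
    ultimately show False using zd w wz dist
    proof (intro no_markable[of "{x, p, q, r, z}" z w x, OF _ _ _ _ _ _ _ _ _ pqr])
      show "nb E v \<subseteq> {x, p, q, r, z}" if "v \<in> {x, p, q, r, z}" "v \<noteq> z" for v
        using that by (auto simp: nbp nbq nbr z(1))
    qed auto
  qed
qed

text \<open>Let \<open>x\<close> and \<open>y\<close> be the outer neighbours of the segment. If
  they lie on it, there is a closed triangle; if they coincide, a square; if they are distinct and
  not adjacent, the segment contracts. If they are adjacent, there is a 5-cycle: both ends cubic is
  excluded, one cubic end gives a pendant pentagon, and none gives a closed five-set.\<close>

lemma no_three_path:
  assumes c: "card (nb E p) = 2" "card (nb E q) = 2" "card (nb E r) = 2"
    and pr: "p \<in> nb E q" "r \<in> nb E q" "p \<noteq> r"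
  shows False
proof -
  have nbq: "nb E q = {p, r}" using card_2_other[OF c(2) pr(1)] pr by auto
  have "q \<in> nb E p" "q \<in> nb E r" using pr nb_symD by metis+
  then obtain x y where x: "nb E p = {q, x}" "x \<noteq> q" and y: "nb E r = {q, y}" "y \<noteq> q"
    using card_2_other[OF c(1)] card_2_other[OF c(3)] by metis
  have nbp: "nb E p = {x, q}" and nbr: "nb E r = {q, y}" using x y by auto
  have px: "p \<in> nb E x" and ry: "r \<in> nb E y" by (simp_all add: nb_sym[of p E x] nb_sym[of r E y] nbp nbr)
  have V: "{x, p, q, r, y} \<subseteq> V" using nb_V nbp nbq nbr by blast
  have irr: "x \<noteq> p" "y \<noteq> r" "q \<noteq> p" "q \<noteq> r" using nb_V px ry pr by blast+
  have pqr: "piece E M {p, q, r}" using nbq irr pr by (intro piece_path) auto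
  show False
  proof (cases "x = r")
    case True
    then have "p = y" using px nbr irr by auto
    then have "closed_in E {p, q, r}" using nbp nbq nbr True by (auto simp: closed_in_def)
    moreover have "packs E M {p, q, r} 1" by (rule packs_one[OF pqr]) auto
    moreover have "card {p, q, r} \<le> 4" by (simp add: card_insert_if)
    ultimately show False using no_closed_packed[of "{p, q, r}" 1] V by simp
  next
    case xr: False
    then have yp: "y \<noteq> p" using ry nbp pr irr by auto
    show False
    proof (cases "x = y")
      case True
      show False using no_pendant_square[OF nbp nbq] nbr True xr irr x pr by auto
    next
      case xy: False
      have dist: "distinct [x, p, q, r, y]" using xy xr yp irr x(2) y(2) pr(3) by auto
      then have dist': "distinct [y, r, q, p, x]" by auto
      have adj: "y \<in> nb E x" using no_contractible[OF nbp nbq nbr dist] by blast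
      then have adj': "x \<in> nb E y" using nb_symD by metis
      have two: "v \<notin> M" if "a \<in> nb E v" "b \<in> nb E v" "a \<noteq> b" for a b v
      proof
        assume "v \<in> M"
        then obtain u where "nb E v = {u}" using mark_card[of v] by (auto simp: card_1_singleton_iff)
        then show False using that by simp
      qed
      have unm: "x \<notin> M" "y \<notin> M" using two[OF px adj] two[OF ry adj'] yp xr by auto
      have unm': "p \<notin> M" "q \<notin> M" "r \<notin> M" using c by (auto intro!: unmarked_if)
      have cx: "card (nb E x) = 2 \<or> card (nb E x) = 3" and cy: "card (nb E y) = 2 \<or> card (nb E y) = 3"
        using unmarked_card unm V by auto
      have nbx: "nb E x = {p, y}" if "card (nb E x) = 2" using card_2_other[OF that px] adj yp by auto
      have nby: "nb E y = {r, x}" if "card (nb E y) = 2" using card_2_other[OF that ry] adj' xr by auto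
      from cx cy consider "card (nb E x) = 3" "card (nb E y) = 3" | "card (nb E x) = 2" "card (nb E y) = 3"
        | "card (nb E x) = 3" "card (nb E y) = 2" | "card (nb E x) = 2" "card (nb E y) = 2" by blast
      then show False
      proof cases
        case 1
        then show False using cubic_independent[OF _ _ adj] by blast
      next
        case 2
        then show False using no_pendant_pentagon[OF nbp nbq nbr nbx adj' _ dist] by blast
      next
        case 3
        \<comment> \<open>The segment is read backwards, so that \<open>x\<close> becomes the
          attaching vertex.\<close>
        have "nb E r = {y, q}" "nb E q = {r, p}" "nb E p = {q, x}" using nbr nbq nbp by auto
        then show False using no_pendant_pentagon[of r y q p x, OF _ _ _ nby[OF 3(2)] adj 3(1) dist'] by blast
      next
        case 4
        have "closed_in E {x, p, q, r, y}" using nbp nbq nbr nbx[OF 4(1)] nby[OF 4(2)]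
          by (auto simp: closed_in_def)
        moreover have "card {x, p, q, r, y} = 5" using dist by simp
        ultimately show False using no_fiveD[of "{x, p, q, r, y}"] V unm unm' by auto
      qed
    qed
  qed
qed

section \<open>Neighbours of marked leaves\<close>

text \<open>The path is followed from \<open>x\<close> through \<open>p\<close>, \<open>w\<close>,
  \<open>u\<close>. Ending at a mark, it is a closed set of at most four vertices, packed by
  \<open>{x, p}\<close>. Reaching a cubic vertex at \<open>w\<close> or \<open>u\<close>, it leaves
  behind a pendant set of at most three vertices packed by the same piece. Otherwise
  \<open>p\<close>, \<open>w\<close>, \<open>u\<close> are three consecutive vertices of degree
  2.\<close>

lemma mark_next_to_cubic:
  assumes x: "x \<in> M" and p: "p \<in> nb E x"
  shows "card (nb E p) = 3"
proof (rule ccontr)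
  assume n3: "card (nb E p) \<noteq> 3"
  have one: "nb E v = {u}" if "v \<in> M" "u \<in> nb E v" for u v
    using mark_card[OF that(1)] that(2) by (auto simp: card_1_singleton_iff)
  have nbx: "nb E x = {p}" by (rule one[OF x p])
  have xp: "x \<in> nb E p" using p by (rule nb_symD)
  have V: "x \<in> V" "p \<in> V" "x \<noteq> p" using nb_V[OF xp] by auto
  have P: "piece E M {x, p}" using x p by (rule piece_mark)
  have pM: "p \<notin> M"
  proof
    assume "p \<in> M"
    then have "nb E p = {x}" using one xp by blast
    then have "closed_in E {x, p}" using nbx by (auto simp: closed_in_def)
    moreover have "packs E M {x, p} 1" using P by (rule packs_one) auto
    ultimately show False using no_closed_packed[of "{x, p}" 1] V by simp
  qed
  then have p2: "card (nb E p) = 2" using unmarked_card n3 V by blast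
  then obtain w where w: "nb E p = {x, w}" "w \<noteq> x" using card_2_other xp by metis
  then have wp: "w \<in> nb E p" "p \<in> nb E w" by (simp_all add: nb_sym[of p E w])
  have wV: "w \<in> V" "w \<noteq> p" using nb_V[OF wp(1)] by auto
  have wM: "w \<notin> M"
  proof
    assume "w \<in> M"
    then have "nb E w = {p}" using one wp by blast
    then have "closed_in E {x, p, w}" using nbx w by (auto simp: closed_in_def)
    moreover have "packs E M {x, p, w} 1" using P by (rule packs_one) auto
    moreover have "card {x, p, w} \<le> 4" by (simp add: card_insert_if)
    ultimately show False using no_closed_packed[of "{x, p, w}" 1] V wV by simp
  qed
  have "card (nb E w) \<noteq> 3"
  proof
    assume w3: "card (nb E w) = 3"
    have "x \<notin> nb E w" using nb_symD[of x E w] nbx wV by auto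
    then have i: "nb E w \<inter> {x, p} = {p}" using wp by auto
    have "packs E M {x, p} 1" using P by (rule packs_one) auto
    moreover have "nb E u \<subseteq> insert w {x, p}" if "u \<in> {x, p}" for u using that nbx w by auto
    ultimately show False
      using no_pendant_packed[of "{x, p}" p w 1] i w3 V w(2) wV by auto
  qed
  then have w2: "card (nb E w) = 2" using unmarked_card wM wV by blast
  then obtain u where u: "nb E w = {p, u}" "u \<noteq> p" using card_2_other wp by metis
  then have uw: "u \<in> nb E w" "w \<in> nb E u" by (simp_all add: nb_sym[of w E u])
  have uV: "u \<in> V" "u \<noteq> w" using nb_V[OF uw(1)] by auto
  have ux: "u \<noteq> x" using uw(2) nbx wV by auto
  have uM: "u \<notin> M"
  proof
    assume "u \<in> M"
    then have "nb E u = {w}" using one uw by blast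
    then have "closed_in E {x, p, w, u}" using nbx w u by (auto simp: closed_in_def)
    moreover have "packs E M {x, p, w, u} 1" using P by (rule packs_one) auto
    moreover have "card {x, p, w, u} \<le> 4" by (simp add: card_insert_if)
    ultimately show False using no_closed_packed[of "{x, p, w, u}" 1] V wV uV by simp
  qed
  have "card (nb E u) \<noteq> 3"
  proof
    assume u3: "card (nb E u) = 3"
    have "x \<notin> nb E u" "p \<notin> nb E u" using nb_symD[of x E u] nb_symD[of p E u] nbx w uV u ux by auto
    then have i: "nb E u \<inter> {x, p, w} = {w}" using uw by auto
    have "packs E M {x, p, w} 1" using P by (rule packs_one) auto
    moreover have "nb E v \<subseteq> insert u {x, p, w}" if "v \<in> {x, p, w}" for v using that nbx w u by auto
    moreover have "card {x, p, w} < 4" by (simp add: card_insert_if)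
    ultimately show False
      using no_pendant_packed[of "{x, p, w}" w u 1] i u3 V wV uV u(2) ux by auto
  qed
  then have "card (nb E u) = 2" using unmarked_card uM uV by blast
  then show False using no_three_path[OF p2 w2 _ wp(2) uw(1)] u(2) by blast
qed

section \<open>The final count by cherries\<close>

lemma contradiction: False
proof -
  define D where "D = {v\<in>V. card (nb E v) = 3}"
  define T where "T = V - D"
  have fin: "finite D" "finite T" using finite_V by (auto simp: D_def T_def)
  have le2: "card (nb E t) \<le> 2" if "t \<in> T" for t
    using that mark_card[of t] unmarked_card[of t] by (force simp: T_def D_def)
  have sub: "{y\<in>D. t \<in> nb E y} \<subseteq> nb E t" for t using nb_symD by fast
  \<comment> \<open>The neighbour of a mark is cubic. An unmarked \<open>t\<close> without a cubic
    neighbour would be the middle of three consecutive vertices of degree 2.\<close>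
  have two: "{y\<in>D. t \<in> nb E y} \<noteq> {} \<and> card {y\<in>D. t \<in> nb E y} \<le> 2" if t: "t \<in> T" for t
  proof
    show "card {y\<in>D. t \<in> nb E y} \<le> 2"
      using card_mono[OF finite_nb[OF simple] sub[of t]] le2[OF t] by simp
    show "{y\<in>D. t \<in> nb E y} \<noteq> {}"
    proof (cases "t \<in> M")
      case True
      then obtain y where "nb E t = {y}" using mark_card[of t] by (auto simp: card_1_singleton_iff)
      then have y: "y \<in> nb E t" by simp
      then have "y \<in> D" using mark_next_to_cubic[OF True] nb_V by (auto simp: D_def)
      then show ?thesis using nb_symD[OF y] by blast
    next
      case False
      then have t2: "card (nb E t) = 2" using t unmarked_card by (auto simp: T_def D_def)
      then obtain a b where ab: "nb E t = {a, b}" "a \<noteq> b" by (auto simp: card_2_iff)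
      then have n: "a \<in> nb E t" "b \<in> nb E t" by auto
      have "card (nb E v) = 2" if v: "v \<in> nb E t" "v \<notin> D" for v
      proof -
        have "v \<notin> M"
        proof
          assume "v \<in> M"
          then have "card (nb E t) = 3" using mark_next_to_cubic nb_symD[OF v(1)] by blast
          then show False using t2 by simp
        qed
        then show ?thesis using unmarked_card[of v] v nb_V[OF v(1)] by (auto simp: D_def)
      qed
      then have "a \<in> D \<or> b \<in> D" using no_three_path[OF _ t2 _ n ab(2)] n by blast
      then show ?thesis using n[THEN nb_symD] by blast
    qed
  qed
  have three: "nb E y \<subseteq> T \<and> card (nb E y) = 3" if "y \<in> D" for y
    using that cubic_independent[of y] nb_V by (auto simp: D_def T_def)
  \<comment> \<open>Two cubic vertices with a common neighbourhood would form with it a closed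
    unmarked copy of K_{2,3}, since their neighbours have degree at most 2.\<close>
  have "inj_on (nb E) D"
  proof (rule inj_onI, rule ccontr)
    fix y z assume yz: "y \<in> D" "z \<in> D" "nb E y = nb E z" "y \<noteq> z"
    have nbt: "nb E t = {y, z} \<and> t \<notin> M" if "t \<in> nb E y" for t
    proof -
      have m: "y \<in> nb E t" "z \<in> nb E t" using that yz(3) nb_symD by metis+
      then have "card {y, z} \<le> card (nb E t)" by (intro card_mono finite_nb[OF simple]) auto
      then have t2: "card (nb E t) = 2" using le2[of t] three[OF yz(1)] that yz(4) by auto
      then show ?thesis using card_2_other[OF _ m(1)] m(2) yz(4) by (auto intro!: unmarked_if)
    qed
    let ?C = "{y, z} \<union> nb E y"
    have "closed_in E ?C" unfolding closed_in_def using nbt yz(3) by auto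
    moreover have "?C \<subseteq> V - M"
    proof -
      have "y \<notin> M" "z \<notin> M" "y \<in> V" "z \<in> V" using yz by (auto simp: D_def intro!: unmarked_if)
      then show ?thesis using nbt nb_V[of _ y] by auto
    qed
    moreover have "card ?C = 5"
    proof -
      have "{y, z} \<inter> nb E y = {}" using three[OF yz(1)] yz(1,2) by (auto simp: T_def)
      then show ?thesis using three[OF yz(1)] yz(4) finite_nb[OF simple]
        by (subst card_Un_disjoint) auto
    qed
    ultimately show False using no_fiveD by blast
  qed
  then obtain f where f: "assignment D T (nb E) f"
    and le: "card D + card T \<le> 4 * card {y\<in>D. 2 \<le> load T f y}"
    using cherry_assignment[of D T "nb E"] fin two three by blast
  let ?C = "{y\<in>D. 2 \<le> load T f y}"
  \<comment> \<open>A load of at least 2 supplies the two ends of a cherry; a third vertex assigned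
    to \<open>y\<close> stays uncovered.\<close>
  have "\<exists>a b. a \<in> T \<and> b \<in> T \<and> a \<noteq> b \<and> f a = y \<and> f b = y" if y: "y \<in> ?C" for y
  proof -
    have "2 \<le> card {t\<in>T. f t = y}" using y by (simp add: load_def)
    then obtain X where "X \<subseteq> {t\<in>T. f t = y}" "card X = 2" by (meson obtain_subset_with_card_n)
    then show ?thesis by (auto simp: card_2_iff)
  qed
  then obtain a b where ab: "\<And>y. y \<in> ?C \<Longrightarrow> a y \<in> T \<and> b y \<in> T \<and> a y \<noteq> b y \<and> f (a y) = y \<and> f (b y) = y"
    by metis
  define S where "S y = {a y, y, b y}" for y
  have TD: "T \<inter> D = {}" by (auto simp: T_def)
  \<comment> \<open>Ends of different cherries differ because each has one owner, and no end is a
    middle vertex because \<open>T\<close> and \<open>D\<close> are disjoint.\<close>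
  have disj: "S y \<inter> S z = {}" if "y \<in> ?C" "z \<in> ?C" "y \<noteq> z" for y z
    using ab[OF that(1)] ab[OF that(2)] that TD unfolding S_def by auto
  have "inj_on S ?C"
    using disj by (force simp: inj_on_def S_def)
  then have "card (S ` ?C) = card ?C" by (rule card_image)
  moreover have "pairwise disjnt (S ` ?C)"
    using disj by (auto simp: pairwise_def disjnt_def)
  moreover have "piece E M (S y) \<and> S y \<subseteq> V" if y: "y \<in> ?C" for y
  proof -
    have "a y \<in> nb E y" "b y \<in> nb E y" using ab[OF y] f by (auto simp: assignment_def)
    moreover have "distinct [a y, y, b y]" using ab[OF y] y TD by auto
    ultimately have "piece E M (S y)" unfolding S_def by (intro piece_path)
    then show ?thesis using ab[OF y] y by (auto simp: S_def D_def T_def)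
  qed
  ultimately have "packs E M V (card ?C)"
    unfolding packs_def using fin by (intro exI[of _ "S ` ?C"]) auto
  moreover have "card V = card D + card T"
  proof -
    have "V = D \<union> T" by (auto simp: D_def T_def)
    then show ?thesis using fin TD by (metis card_Un_disjoint inf_commute)
  qed
  ultimately show False using not_packs le by simp
qed

end

lemma marked_graph_quarter_packed:
  assumes "marked_graph V E M" "no_closed_five V E M"
  shows "quarter_packed V E M"
  using assms
proof (induction "card V + card E" arbitrary: V E M rule: less_induct)
  case less
  show ?case
  proof (rule ccontr)
    assume "\<not> quarter_packed V E M"
    with less have "critical V E M" by unfold_locales auto
    then show False by (rule critical.contradiction)
  qed
qed

section \<open>Unmarked graphs\<close>

text \<open>The reachability class \<open>B\<close> of a vertex of \<open>C\<close> and its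
  complement \<open>C - B\<close> are both closed. A nonempty closed part contains a vertex and at
  least two neighbours, so two such parts would need six vertices.\<close>

lemma closed_five_is_component:
  assumes G: "in_G 2 3 V E" and C: "C \<subseteq> V" "closed_in E C" "card C = 5"
  shows "C \<in> components V E"
proof -
  have simple: "simple_graph V E" using G by (simp add: in_G_def)
  have deg: "2 \<le> card (nb E v)" if "v \<in> V" for v
    using G that by (simp add: in_G_def degree_eq_card_nb[OF simple])
  have finC: "finite C" using C(3) by (simp add: card_ge_0_finite)
  have big: "3 \<le> card B" if B: "B \<subseteq> C" "closed_in E B" "v \<in> B" for B v
  proof -
    have "insert v (nb E v) \<subseteq> B" using B by (auto simp: closed_in_def)
    moreover have "v \<notin> nb E v" using nb_subset[OF simple] by blast
    then have "3 \<le> card (insert v (nb E v))"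
      using deg[of v] B C(1) finite_nb[OF simple, of v] by auto
    ultimately show ?thesis using card_mono[of B "insert v (nb E v)"] B(1) finC finite_subset by fastforce
  qed
  obtain v where v: "v \<in> C" using C(3) by fastforce
  define B where "B = {w. reachable V E v w}"
  have step: "z \<in> B" if "y \<in> B" "z \<in> nb E y" for y z
    using that nb_subset[OF simple, of y] unfolding B_def reachable_def nb_def
    by (auto intro: rtrancl_into_rtrancl)
  have "w \<in> C" if "(v, w) \<in> {(x, y). {x, y} \<in> E}\<^sup>*" for w
    using that by induction (use v C(2) in \<open>auto simp: closed_in_def nb_def\<close>)
  then have BC: "B \<subseteq> C" by (auto simp: B_def reachable_def)
  have vB: "v \<in> B" using v C by (auto simp: B_def reachable_def)
  have clB: "closed_in E B" using step by (auto simp: closed_in_def)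
  have "C - B = {}"
  proof (rule ccontr)
    assume "C - B \<noteq> {}"
    then obtain w where w: "w \<in> C - B" by blast
    have "closed_in E (C - B)"
      using C(2) step nb_symD[of _ E] by (fastforce simp: closed_in_def)
    then have "3 \<le> card (C - B)" using big w by blast
    moreover have "3 \<le> card B" using big[OF BC clB vB] .
    moreover have "card (C - B) = card C - card B" using BC finC by (simp add: card_Diff_subset finite_subset)
    ultimately show False using C(3) by simp
  qed
  then have "C = B" using BC by blast
  then show ?thesis using v C unfolding components_def B_def by blast
qed

text \<open>Without marks every piece comes from a path. Choosing one ordered triple for each piece
  is injective, because the triple determines the vertex set.\<close>

lemma packs_lambda_P3:
  assumes simple: "simple_graph V E" and p: "packs E {} V m"
  shows "m \<le> lambda_P3 V E"
proof -
  obtain F where F: "finite F" "card F = m" "pairwise disjnt F" "\<And>S. S \<in> F \<Longrightarrow> piece E {} S"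
    using p unfolding packs_def by blast
  have "\<exists>t. is_P3 E t \<and> P3_verts t = S" if S: "S \<in> F" for S
  proof -
    obtain a b c where "distinct [a, b, c]" "{a, b} \<in> E" "{b, c} \<in> E" "S = {a, b, c}"
      using F(4)[OF S] unfolding piece_def by blast
    then show ?thesis by (intro exI[of _ "(a, b, c)"]) (auto simp: is_P3_def P3_verts_def)
  qed
  then obtain g where g: "\<And>S. S \<in> F \<Longrightarrow> is_P3 E (g S) \<and> P3_verts (g S) = S" by metis
  have "inj_on g F" using g by (metis inj_onI)
  then have "card (g ` F) = m" using F(2) by (simp add: card_image)
  moreover have "P3_packing E (g ` F)"
    unfolding P3_packing_def
  proof (intro conjI ballI impI)
    fix p q assume pq: "p \<in> g ` F" "q \<in> g ` F" "p \<noteq> q"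
    then obtain S T where "S \<in> F" "T \<in> F" "p = g S" "q = g T" "S \<noteq> T" by blast
    then show "P3_verts p \<inter> P3_verts q = {}"
      using F(3) g[of S] g[of T] by (auto simp: pairwise_def disjnt_def)
  qed (use F(1) g in auto)
  \<comment> \<open>\<open>Max\<close> bounds its elements only on a finite set; here packings are
    subsets of the finite set of triples over \<open>V\<close>.\<close>
  moreover have "finite (card ` {P. P3_packing E P})"
  proof -
    have "t \<in> V \<times> V \<times> V" if "is_P3 E t" for t
    proof -
      have "e \<subseteq> V" if "e \<in> E" for e using simple that by (simp add: simple_graph_def)
      then show ?thesis using that by (cases t) (auto simp: is_P3_def)
    qed
    then have "{P. P3_packing E P} \<subseteq> Pow (V \<times> V \<times> V)" by (auto simp: P3_packing_def)
    moreover have "finite (Pow (V \<times> V \<times> V))" using simple by (simp add: simple_graph_def)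
    ultimately show ?thesis using finite_subset by blast
  qed
  ultimately show ?thesis unfolding lambda_P3_def by (intro Max_ge) auto
qed

theorem theorem1p6:
  fixes V :: "'a set" and E :: "'a set set"
  assumes "in_G 2 3 V E"
    and "\<forall>C\<in>components V E. card C \<noteq> 5"
  shows "real (lambda_P3 V E) \<ge> real (card V) / 4"
proof -
  have simple: "simple_graph V E" using assms(1) by (simp add: in_G_def)
  have "2 \<le> card (nb E v) \<and> card (nb E v) \<le> 3" if "v \<in> V" for v
    using assms(1) that by (simp add: in_G_def degree_eq_card_nb[OF simple])
  then have "card (nb E v) = 2 \<or> card (nb E v) = 3" if "v \<in> V" for v
    using that by (metis le_antisym not_less_eq_eq numeral_2_eq_2 numeral_3_eq_3)
  then have "marked_graph V E {}"
    unfolding marked_graph_def using simple by blast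
  moreover have "no_closed_five V E {}"
    unfolding no_closed_five_def using closed_five_is_component[OF assms(1)] assms(2) by auto
  ultimately have "quarter_packed V E {}" by (rule marked_graph_quarter_packed)
  then obtain m where m: "packs E {} V m" "card V \<le> 4 * m" unfolding quarter_packed_def by blast
  then show ?thesis using packs_lambda_P3[OF simple m(1)] by linarith
qed

end
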